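(* Let $X$ be an arbitrary symmetric sequence space. Then the set $\mathcal F(X)$ is nonempty, its largest element is $1/\alpha_X$ and its smallest element is $1/\beta_X$ (with the convention $1/0=\infty$).
   Context: A Banach sequence lattice is a Banach space $E$ of real sequences such that $x\in E$, $|y_k|\le|x_k|$ imply $y\in E$, $\|y\|_E\le\|x\|_E$. $u^*$ is the nonincreasing rearrangement of $(|u_k|)$. A symmetric sequence space is a Banach sequence lattice $X\subset\ell^\infty$ such that $x\in X$, $y^*=x^*$ imply $y\in X$, $\|y\|_X=\|x\|_X$; standing assumption: $X$ is separable or has the Fatou property. Dilations: $\sigma_ma=(a_{[(m-1+n)/m]})_n$, $\sigma_{1/m}a=(\frac1m\sum_{k=(n-1)m+1}^{nm}a_k)_n$; Boyd indices $\alpha_X=-\lim_{m}\frac{\log_2\|\sigma_{1/m}\|_X}{\log_2m}$, $\beta_X=\lim_m\frac{\log_2\|\sigma_m\|_X}{\log_2m}$. Sequences $x,y$ have the same ordered distribution if $y_{\pi(k)}=x_k$ for all $k$ for some permutation $\pi$ of $\mathbb N$. For $1\le p\le\infty$, $\ell^p$ is symmetrically finitely represented in $X$ if for every $n\in\mathbb N$ and $\varepsilon>0$ there exist pairwise disjointly supported $x_1,\dots,x_n\in X$, pairwise having the same ordered distribution, with $(1+\varepsilon)^{-1}\|a\|_p\le\|\sum_{k=1}^na_kx_k\|_X\le(1+\varepsilon)\|a\|_p$ for all $a\in\mathbb R^n$ ($\|\cdot\|_\infty$ being the max norm). $\mathcal F(X)$ is the set of all $p\in[1,\infty]$ such that $\ell^p$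 is symmetrically finitely represented in $X$. *)

theory Defs
  imports "HOL-Analysis.Analysis"
begin

text \<open>Sequences are functions nat => real, indexed from 0 (the paper indexes from 1).
  A space is a set X of sequences together with a norm function N (only relevant on X).\<close>

definition banach_seq_lattice :: "(nat \<Rightarrow> real) set \<Rightarrow> ((nat \<Rightarrow> real) \<Rightarrow> real) \<Rightarrow> bool" where
  "banach_seq_lattice E N \<longleftrightarrow>
     (\<lambda>k. 0) \<in> E \<and>
     (\<forall>x\<in>E. \<forall>y\<in>E. (\<lambda>k. x k + y k) \<in> E) \<and>
     (\<forall>c. \<forall>x\<in>E. (\<lambda>k. c * x k) \<in> E) \<and>
     (\<forall>x\<in>E. 0 \<le> N x \<and> (N x = 0 \<longleftrightarrow> x = (\<lambda>k. 0))) \<and>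
     (\<forall>x\<in>E. \<forall>y\<in>E. N (\<lambda>k. x k + y k) \<le> N x + N y) \<and>
     (\<forall>c. \<forall>x\<in>E. N (\<lambda>k. c * x k) = \<bar>c\<bar> * N x) \<and>
     (\<forall>s. (\<forall>i. s i \<in> E) \<and>
          (\<forall>e>0. \<exists>M. \<forall>m\<ge>M. \<forall>n\<ge>M. N (\<lambda>k. s m k - s n k) < e) \<longrightarrow>
          (\<exists>x\<in>E. (\<lambda>i. N (\<lambda>k. s i k - x k)) \<longlonglongrightarrow> 0)) \<and>
     (\<forall>x\<in>E. \<forall>y. (\<forall>k. \<bar>y k\<bar> \<le> \<bar>x k\<bar>) \<longrightarrow> y \<in> E \<and> N y \<le> N x)"

definition decr_rearr :: "(nat \<Rightarrow> real) \<Rightarrow> nat \<Rightarrow> real" where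
  "decr_rearr u n = Inf {t. 0 \<le> t \<and> finite {k. \<bar>u k\<bar> > t} \<and> card {k. \<bar>u k\<bar> > t} \<le> n}"

definition symmetric_seq_space :: "(nat \<Rightarrow> real) set \<Rightarrow> ((nat \<Rightarrow> real) \<Rightarrow> real) \<Rightarrow> bool" where
  "symmetric_seq_space X N \<longleftrightarrow>
     banach_seq_lattice X N \<and>
     (\<forall>x\<in>X. bounded (range x)) \<and>
     (\<forall>x\<in>X. \<forall>y. bounded (range y) \<and> decr_rearr y = decr_rearr x \<longrightarrow> y \<in> X \<and> N y = N x)"

definition separable_space :: "(nat \<Rightarrow> real) set \<Rightarrow> ((nat \<Rightarrow> real) \<Rightarrow> real) \<Rightarrow> bool" where
  "separable_space X N \<longleftrightarrow>
     (\<exists>D. countable D \<and> D \<subseteq> X \<and> (\<forall>x\<in>X. \<forall>e>0. \<exists>d\<in>D. N (\<lambda>k. x k - d k) < e))"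

definition fatou_property :: "(nat \<Rightarrow> real) set \<Rightarrow> ((nat \<Rightarrow> real) \<Rightarrow> real) \<Rightarrow> bool" where
  "fatou_property X N \<longleftrightarrow>
     (\<forall>s x. (\<forall>i. s i \<in> X) \<and> (\<forall>i k. 0 \<le> s i k \<and> s i k \<le> s (Suc i) k) \<and>
            (\<forall>k. (\<lambda>i. s i k) \<longlonglongrightarrow> x k) \<and> bdd_above (range (\<lambda>i. N (s i)))
        \<longrightarrow> x \<in> X \<and> N x = (SUP i. N (s i)))"

definition dil_up :: "nat \<Rightarrow> (nat \<Rightarrow> real) \<Rightarrow> nat \<Rightarrow> real" where
  "dil_up m a = (\<lambda>n. a (n div m))"

definition dil_down :: "nat \<Rightarrow> (nat \<Rightarrow> real) \<Rightarrow> nat \<Rightarrow> real" where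
  "dil_down m a = (\<lambda>n. (1 / real m) * (\<Sum>k = n * m..<n * m + m. a k))"

definition op_norm :: "(nat \<Rightarrow> real) set \<Rightarrow> ((nat \<Rightarrow> real) \<Rightarrow> real) \<Rightarrow>
    ((nat \<Rightarrow> real) \<Rightarrow> (nat \<Rightarrow> real)) \<Rightarrow> real" where
  "op_norm X N T = (SUP x\<in>{x\<in>X. N x \<le> 1}. N (T x))"

definition boyd_alpha :: "(nat \<Rightarrow> real) set \<Rightarrow> ((nat \<Rightarrow> real) \<Rightarrow> real) \<Rightarrow> real" where
  "boyd_alpha X N = - lim (\<lambda>m. log 2 (op_norm X N (dil_down m)) / log 2 (real m))"

definition boyd_beta :: "(nat \<Rightarrow> real) set \<Rightarrow> ((nat \<Rightarrow> real) \<Rightarrow> real) \<Rightarrow> real" where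
  "boyd_beta X N = lim (\<lambda>m. log 2 (op_norm X N (dil_up m)) / log 2 (real m))"

definition lp_norm :: "ereal \<Rightarrow> nat \<Rightarrow> (nat \<Rightarrow> real) \<Rightarrow> real" where
  "lp_norm p n a = (if p = \<infinity> then (if n = 0 then 0 else Max ((\<lambda>i. \<bar>a i\<bar>) ` {..<n}))
                    else (\<Sum>i<n. \<bar>a i\<bar> powr real_of_ereal p) powr (1 / real_of_ereal p))"

definition same_ordered_distribution :: "(nat \<Rightarrow> real) \<Rightarrow> (nat \<Rightarrow> real) \<Rightarrow> bool" where
  "same_ordered_distribution x y \<longleftrightarrow> (\<exists>\<pi>. bij \<pi> \<and> (\<forall>k. y (\<pi> k) = x k))"

definition sym_fin_rep :: "ereal \<Rightarrow> (nat \<Rightarrow> real) set \<Rightarrow> ((nat \<Rightarrow> real) \<Rightarrow> real) \<Rightarrow> bool" where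
  "sym_fin_rep p X N \<longleftrightarrow>
     (\<forall>n::nat. \<forall>\<epsilon>>0. \<exists>x :: nat \<Rightarrow> nat \<Rightarrow> real.
        (\<forall>i<n. x i \<in> X) \<and>
        (\<forall>i<n. \<forall>j<n. i \<noteq> j \<longrightarrow> (\<forall>k. x i k = 0 \<or> x j k = 0)) \<and>
        (\<forall>i<n. \<forall>j<n. same_ordered_distribution (x i) (x j)) \<and>
        (\<forall>a :: nat \<Rightarrow> real.
            lp_norm p n a / (1 + \<epsilon>) \<le> N (\<lambda>k. \<Sum>i<n. a i * x i k) \<and>
            N (\<lambda>k. \<Sum>i<n. a i * x i k) \<le> (1 + \<epsilon>) * lp_norm p n a))"

definition F_set :: "(nat \<Rightarrow> real) set \<Rightarrow> ((nat \<Rightarrow> real) \<Rightarrow> real) \<Rightarrow> ereal set" where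
  "F_set X N = {p. 1 \<le> p \<and> sym_fin_rep p X N}"

definition recip :: "real \<Rightarrow> ereal" where
  "recip a = (if a = 0 then \<infinity> else ereal (1 / a))"

end

theory Submission
  imports Defs "HOL-Real_Asymp.Real_Asymp"
begin

text \<open>The norm of $\sigma_m x$ compares with that of $x$ between a lower and an upper growth factor; both
  are multiplicative up to inequality and monotone in $m$, so Fekete's argument identifies their
  logarithmic limits as the two Boyd indices. (The lower factor is the inverse of the norm of
  $\sigma_{1/m}$, because $\sigma_m\sigma_{1/m}$ averages over blocks and is a contraction.) If $\ell^p$ is
  symmetrically finitely represented, summing $n$ disjoint copies puts $n^{1/p}$ between these factors.
  Conversely let $\gamma$ be one of the indices. Since $2^\gamma$ is an extreme growth rate
  of $\sigma_2$ on decreasing sequences, geometrically weighted orbit sums of $\sigma_2$ are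
  approximate eigenvectors for $2^\gamma$. Averaging $j^{-1-\gamma}\sigma_j f$ over a long range of $j$
  then gives $g$ with $\sigma_m g \approx m^\gamma g$ for all $m \le M$ at once.
  In a combination of disjoint copies of $g$, a copy with coefficient $(k_i/K)^\gamma$ may be replaced by
  $K^{-\gamma}$ times $k_i$ copies of $g$, and the total is $K^{-\gamma}\sigma_{\sum k_i} g$.\<close>

section \<open>Equidistributed sequences\<close>

text \<open>\<open>\<sigma>_2\<close> need not have an exact eigenvector in X, and an approximate
  one says something precise only about dilations by powers of 2. For the other m monotonicity loses
  a constant factor, which the bounds \<open>1 + \<epsilon>\<close> do not tolerate; this is why an
  average over all dilations is needed. The weight \<open>j powr (- 1 - \<gamma>)\<close> is a
  discrete form of \<open>t^(-\<gamma>) dt/t\<close>, and \<open>dt/t\<close> is invariant under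
  dilation. Hence dilating the average by m and dividing by \<open>m powr \<gamma>\<close> only
  moves its range of summation, up to rounding errors that telescope. The error stays bounded in the
  length of the range, while the norm of the average grows like the logarithm of that length, so the
  relative error tends to 0. The work is done on the cone of decreasing sequences: there
  \<open>dil_up m f\<close> increases pointwise with m and positive sums cannot cancel.
  Rearrangement carries norms of dilations from this cone to all of X. The order of choices matters
  throughout: the length of the range is fixed before the precision of the eigenvector, and the
  damping factor near 1 after the length of the undamped orbit sum.\<close>

definition level :: "(nat \<Rightarrow> real) \<Rightarrow> real \<Rightarrow> nat set" where
  "level x t = {k. \<bar>x k\<bar> > t}"

text \<open>Cardinality with value $\infty$ on infinite sets, where \<open>card\<close> would be $0$.\<close>

definition csize :: "nat set \<Rightarrow> ennreal" where
  "csize A = emeasure (count_space UNIV) A"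

text \<open>Sizes of level sets add up over disjoint supports, which values of
  \<open>decr_rearr\<close> do not. Restricting to \<open>t \<ge> 0\<close> never counts zero
  entries, so inserting zeros is harmless and no permutation of indices is involved.\<close>

definition eqdist :: "(nat \<Rightarrow> real) \<Rightarrow> (nat \<Rightarrow> real) \<Rightarrow> bool" where
  "eqdist x y \<longleftrightarrow> (\<forall>t\<ge>0. csize (level x t) = csize (level y t))"

lemma csize_eq: "csize A = (if finite A then of_nat (card A) else \<infinity>)"
  by (simp add: csize_def emeasure_count_space)

lemma csize_eq_iff: "csize A = csize B \<longleftrightarrow> (finite A \<longleftrightarrow> finite B) \<and> card A = card B"
  by (auto simp: csize_eq)

lemma csize_inj_image: "inj f \<Longrightarrow> csize (f ` A) = csize A"
  by (metis csize_eq card_image finite_image_iff inj_on_subset subset_UNIV)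

lemma csize_UN_disjoint:
  assumes "\<And>i j. i < n \<Longrightarrow> j < n \<Longrightarrow> i \<noteq> j \<Longrightarrow> A i \<inter> A j = {}"
  shows "csize (\<Union>i<(n::nat). A i) = (\<Sum>i<n. csize (A i))"
  unfolding csize_def
  by (rule sum_emeasure[symmetric]) (use assms in \<open>auto simp: disjoint_family_on_def\<close>)

lemma eqdist_sym: "eqdist x y \<Longrightarrow> eqdist y x"
  by (simp add: eqdist_def)

lemma eqdist_decr_rearr:
  assumes "eqdist x y"
  shows "decr_rearr x = decr_rearr y"
proof
  fix n
  have "{t. 0 \<le> t \<and> finite {k. \<bar>x k\<bar> > t} \<and> card {k. \<bar>x k\<bar> > t} \<le> n}
      = {t. 0 \<le> t \<and> finite {k. \<bar>y k\<bar> > t} \<and> card {k. \<bar>y k\<bar> > t} \<le> n}"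
    using assms by (auto simp: eqdist_def csize_eq_iff level_def)
  then show "decr_rearr x n = decr_rearr y n"
    by (simp add: decr_rearr_def)
qed

text \<open>The symmetry axiom asks for a bounded second sequence; the empty level set at a bound
  \<open>B \<ge> 0\<close> of the first one transfers.\<close>

lemma eqdist_bounded:
  assumes "eqdist x y" "bounded (range x)"
  shows "bounded (range y)"
proof -
  obtain B where B: "\<And>k. \<bar>x k\<bar> \<le> B"
    using assms(2) by (auto simp: bounded_iff)
  have "0 \<le> B" using B[of 0] by linarith
  have "level x B = {}" using B by (auto simp: level_def not_less)
  then have "level y B = {}"
    using assms(1) \<open>0 \<le> B\<close> unfolding eqdist_def csize_eq_iff
    by (metis card_0_eq finite.emptyI)
  then show ?thesis
    by (auto simp: bounded_iff level_def not_less intro!: exI[of _ B])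
qed

lemma eqdist_comp_bij:
  assumes "bij \<pi>"
  shows "eqdist (\<lambda>k. x (\<pi> k)) x"
proof -
  have "level x t = \<pi> ` level (\<lambda>k. x (\<pi> k)) t" for t
    using surj_image_vimage_eq[OF bij_is_surj[OF assms], of "level x t"] by (simp add: level_def vimage_def)
  then show ?thesis
    by (simp add: eqdist_def csize_inj_image bij_is_inj[OF assms])
qed

definition spread :: "nat \<Rightarrow> nat \<Rightarrow> (nat \<Rightarrow> real) \<Rightarrow> nat \<Rightarrow> real" where
  "spread n i x = (\<lambda>k. if k mod n = i then x (k div n) else 0)"

definition interleave :: "nat \<Rightarrow> (nat \<Rightarrow> nat \<Rightarrow> real) \<Rightarrow> nat \<Rightarrow> real" where
  "interleave n y = (\<lambda>k. y (k mod n) (k div n))"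

lemma interleave_spread: "0 < n \<Longrightarrow> interleave n y = (\<lambda>k. \<Sum>i<n. spread n i (y i) k)"
  by (auto simp: interleave_def spread_def sum.delta' intro!: ext)

lemma dil_up_interleave: "dil_up n x = interleave n (\<lambda>i. x)"
  by (simp add: dil_up_def interleave_def)

lemma eqdist_spread:
  assumes "i < n"
  shows "eqdist (spread n i x) x"
proof -
  have "level (spread n i x) t = (\<lambda>q. q * n + i) ` level x t" if "0 \<le> t" for t
    using that assms
    by (auto simp: level_def spread_def image_iff split: if_splits) (metis div_mult_mod_eq)
  moreover have "inj (\<lambda>q. q * n + i)"
    using assms by (auto simp: inj_def)
  ultimately show ?thesis
    by (simp add: eqdist_def csize_inj_image)
qed

lemma csize_level_interleave:
  assumes "0 < n"
  shows "csize (level (interleave n y) t) = (\<Sum>i<n. csize (level (y i) t))"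
proof -
  have "level (interleave n y) t = (\<Union>i<n. (\<lambda>q. q * n + i) ` level (y i) t)"
  proof (intro equalityI subsetI)
    fix k assume "k \<in> level (interleave n y) t"
    then show "k \<in> (\<Union>i<n. (\<lambda>q. q * n + i) ` level (y i) t)"
      using assms by (auto simp: level_def interleave_def image_iff intro!: bexI[of _ "k mod n"] exI[of _ "k div n"])
  qed (auto simp: level_def interleave_def)
  moreover have "csize ((\<lambda>q. q * n + i) ` level (y i) t) = csize (level (y i) t)" for i
    by (rule csize_inj_image) (use assms in \<open>auto simp: inj_def\<close>)
  moreover have "(\<lambda>q. q * n + i) ` A \<inter> (\<lambda>q. q * n + j) ` B = {}"
    if "i < n" "j < n" "i \<noteq> j" for i j A B
  proof -
    have "q * n + i \<noteq> q' * n + j" for q q'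
      using that by (metis mod_less mod_mult_self3)
    then show ?thesis by auto
  qed
  ultimately show ?thesis
    by (simp add: csize_UN_disjoint)
qed

lemma csize_level_dil_up:
  assumes "0 < n"
  shows "csize (level (dil_up n x) t) = of_nat n * csize (level x t)"
  using csize_level_interleave[OF assms, of "\<lambda>i. x" t] by (simp add: dil_up_interleave)

lemma eqdist_dil_up:
  assumes "0 < n" "eqdist x y"
  shows "eqdist (dil_up n x) (dil_up n y)"
  using assms by (simp add: eqdist_def csize_level_dil_up)

text \<open>A dilation by \<open>k i\<close> counts as \<open>k i\<close> disjoint copies of
  \<open>x\<close>, and copies in different slots add up. Multiplicity 0 is treated apart because
  \<open>dil_up 0 x\<close> is the constant sequence with value \<open>x 0\<close> (division by 0
  gives 0), not the zero sequence.\<close>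

lemma eqdist_interleave_dil_up:
  assumes "0 < n" "\<And>i. i < n \<Longrightarrow> y i = (if k i = 0 then (\<lambda>_. 0) else dil_up (k i) x)"
    and "0 < (\<Sum>i<n. k i)"
  shows "eqdist (interleave n y) (dil_up (\<Sum>i<n. k i) x)"
  unfolding eqdist_def
proof (intro allI impI)
  fix t :: real assume "0 \<le> t"
  then have *: "csize (level (y i) t) = of_nat (k i) * csize (level x t)" if "i < n" for i
    using assms(2)[OF that] by (cases "k i = 0") (simp_all add: csize_level_dil_up, simp add: level_def csize_eq)
  show "csize (level (interleave n y) t) = csize (level (dil_up (\<Sum>i<n. k i) x) t)"
    using * by (simp add: csize_level_interleave assms csize_level_dil_up sum_distrib_right)
qed

text \<open>Needed for the sequences supplied by \<open>sym_fin_rep\<close>, whose disjoint supports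
  are arbitrary rather than residue classes.\<close>

lemma eqdist_sum_disjoint:
  assumes "0 < n"
    and disj: "\<And>i j k. i < n \<Longrightarrow> j < n \<Longrightarrow> i \<noteq> j \<Longrightarrow> x i k = 0 \<or> x j k = 0"
    and eq: "\<And>i. i < n \<Longrightarrow> eqdist (x i) z"
  shows "eqdist (\<lambda>k. \<Sum>i<n. x i k) (dil_up n z)"
  unfolding eqdist_def
proof (intro allI impI)
  fix t :: real assume t: "0 \<le> t"
  have single: "(\<Sum>i<n. x i k) = x j k" if "j < n" "x j k \<noteq> 0" for j k
  proof -
    have "(\<Sum>i<n. x i k) = (\<Sum>i<n. if i = j then x j k else 0)"
      using disj that by (intro sum.cong) auto
    then show ?thesis using that by simp
  qed
  have "level (\<lambda>k. \<Sum>i<n. x i k) t = (\<Union>i<n. level (x i) t)"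
  proof (intro equalityI subsetI)
    fix k assume k: "k \<in> level (\<lambda>k. \<Sum>i<n. x i k) t"
    then have "(\<Sum>i<n. x i k) \<noteq> 0" using t by (auto simp: level_def)
    then obtain j where "j < n" "x j k \<noteq> 0" by (metis lessThan_iff sum.neutral)
    then show "k \<in> (\<Union>i<n. level (x i) t)" using k single by (auto simp: level_def)
  next
    fix k assume "k \<in> (\<Union>i<n. level (x i) t)"
    then obtain j where "j < n" "t < \<bar>x j k\<bar>" by (auto simp: level_def)
    then show "k \<in> level (\<lambda>k. \<Sum>i<n. x i k) t" using t single[of j k] by (auto simp: level_def)
  qed
  moreover have "level (x i) t \<inter> level (x j) t = {}" if "i < n" "j < n" "i \<noteq> j" for i j
    using disj[OF that] t by (auto simp: level_def) (metis abs_zero not_less)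
  moreover have "(\<Sum>i<n. csize (level (x i) t)) = (\<Sum>i<n. csize (level z t))"
    using eq t by (intro sum.cong) (auto simp: eqdist_def)
  ultimately show "csize (level (\<lambda>k. \<Sum>i<n. x i k) t) = csize (level (dil_up n z) t)"
    by (simp add: csize_UN_disjoint csize_level_dil_up assms(1))
qed

section \<open>The decreasing rearrangement and its level sets\<close>

lemma decr_rearr_le_iff:
  assumes "bounded (range x)" "0 \<le> t"
  shows "decr_rearr x n \<le> t \<longleftrightarrow> finite (level x t) \<and> card (level x t) \<le> n"
proof -
  define S where "S = {t. 0 \<le> t \<and> finite (level x t) \<and> card (level x t) \<le> n}"
  have Inf: "decr_rearr x n = Inf S"
    by (simp add: decr_rearr_def S_def level_def)
  have bdd: "bdd_below S" by (auto simp: S_def intro!: bdd_belowI[of _ 0])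
  obtain B where B: "\<And>k. \<bar>x k\<bar> \<le> B"
    using assms(1) by (auto simp: bounded_iff)
  have "level x B = {}" using B by (auto simp: level_def not_less)
  moreover have "0 \<le> B" using B[of 0] by linarith
  ultimately have ne: "S \<noteq> {}" by (auto simp: S_def intro!: exI[of _ B])
  show ?thesis
  proof
    assume "finite (level x t) \<and> card (level x t) \<le> n"
    then show "decr_rearr x n \<le> t"
      using assms(2) unfolding Inf by (intro cInf_lower bdd) (auto simp: S_def)
  next
    assume le: "decr_rearr x n \<le> t"
    have above: "finite (level x s) \<and> card (level x s) \<le> n" if "t < s" for s
    proof -
      have "Inf S < s" using le that unfolding Inf by simp
      then obtain s' where s': "s' \<in> S" "s' < s"
        using cInf_less_iff[OF ne bdd] by blast
      have "level x s \<subseteq> level x s'" using s' by (auto simp: level_def)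
      then show ?thesis
        using s' card_mono[of "level x s'" "level x s"] finite_subset by (fastforce simp: S_def)
    qed
    \<comment> \<open>Right continuity of the distribution function: a finite part of the level set
      at \<open>t\<close> still exceeds some \<open>s > t\<close>, halfway up to its smallest entry.
      So the infimum defining \<open>decr_rearr\<close> is attained.\<close>
    have small: "card F \<le> n" if "finite F" "F \<subseteq> level x t" for F
    proof (cases "F = {}")
      case False
      define s where "s = (t + Min ((\<lambda>k. \<bar>x k\<bar>) ` F)) / 2"
      have "t < Min ((\<lambda>k. \<bar>x k\<bar>) ` F)"
        using that False by (auto simp: level_def)
      then have "t < s" "s < Min ((\<lambda>k. \<bar>x k\<bar>) ` F)" by (auto simp: s_def)
      then have "F \<subseteq> level x s"
        using that False by (auto simp: level_def)
      then show ?thesis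
        using above[OF \<open>t < s\<close>] card_mono by (meson le_trans)
    qed simp
    have "finite (level x t)"
    proof (rule ccontr)
      assume "infinite (level x t)"
      then obtain F where "finite F" "F \<subseteq> level x t" "card F = Suc n"
        using infinite_arbitrarily_large by metis
      then show False using small[of F] by auto
    qed
    then show "finite (level x t) \<and> card (level x t) \<le> n" using small by auto
  qed
qed

lemma decr_rearr_nonneg:
  assumes "bounded (range x)"
  shows "0 \<le> decr_rearr x n"
proof -
  obtain B where B: "\<And>k. \<bar>x k\<bar> \<le> B"
    using assms by (auto simp: bounded_iff)
  have "level x B = {}" using B by (auto simp: level_def not_less)
  moreover have "0 \<le> B" using B[of 0] by linarith
  ultimately have ne: "{t. 0 \<le> t \<and> finite (level x t) \<and> card (level x t) \<le> n} \<noteq> {}"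
    by (auto intro!: exI[of _ B])
  show ?thesis
    unfolding decr_rearr_def using ne by (intro cInf_greatest) (auto simp: level_def)
qed

lemma decr_rearr_antimono:
  assumes "bounded (range x)" "m \<le> n"
  shows "decr_rearr x n \<le> decr_rearr x m"
proof -
  have "finite (level x (decr_rearr x m)) \<and> card (level x (decr_rearr x m)) \<le> m"
    using decr_rearr_le_iff[OF assms(1) decr_rearr_nonneg[OF assms(1)]] by blast
  then show ?thesis
    using assms by (subst decr_rearr_le_iff) (auto simp: decr_rearr_nonneg)
qed

text \<open>Since the infimum is attained, \<open>decr_rearr x n > t\<close> holds exactly when more
  than \<open>n\<close> entries exceed \<open>t\<close>; the level set is an initial segment of the
  right length, or everything.\<close>

lemma eqdist_decr_rearr_self:
  assumes "bounded (range x)"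
  shows "eqdist (decr_rearr x) x"
  unfolding eqdist_def
proof (intro allI impI)
  fix t :: real assume t: "0 \<le> t"
  have "level (decr_rearr x) t = {n. \<not> (finite (level x t) \<and> card (level x t) \<le> n)}"
    using decr_rearr_le_iff[OF assms t] decr_rearr_nonneg[OF assms]
    by (auto simp: level_def[of "decr_rearr x"] abs_of_nonneg not_le[symmetric])
  then have "level (decr_rearr x) t = (if finite (level x t) then {..<card (level x t)} else UNIV)"
    by (auto simp: not_le)
  then show "csize (level (decr_rearr x) t) = csize (level x t)"
    by (simp add: csize_eq)
qed

section \<open>Norms of dilations\<close>

locale sym_space =
  fixes X :: "(nat \<Rightarrow> real) set" and N :: "(nat \<Rightarrow> real) \<Rightarrow> real"
  assumes sym: "symmetric_seq_space X N"
begin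

lemma lattice: "banach_seq_lattice X N"
  using sym by (simp add: symmetric_seq_space_def)

lemma zero_in: "(\<lambda>k. 0) \<in> X"
  using lattice unfolding banach_seq_lattice_def by (elim conjE)

lemma add_in: "x \<in> X \<Longrightarrow> y \<in> X \<Longrightarrow> (\<lambda>k. x k + y k) \<in> X"
  using lattice unfolding banach_seq_lattice_def by (elim conjE) blast

lemma scale_in: "x \<in> X \<Longrightarrow> (\<lambda>k. c * x k) \<in> X"
  using lattice unfolding banach_seq_lattice_def by (elim conjE) blast

lemma N_nonneg: "x \<in> X \<Longrightarrow> 0 \<le> N x"
  using lattice unfolding banach_seq_lattice_def by (elim conjE) blast

lemma N_eq_0: "x \<in> X \<Longrightarrow> N x = 0 \<longleftrightarrow> x = (\<lambda>k. 0)"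
  using lattice unfolding banach_seq_lattice_def by (elim conjE) blast

lemma N_add: "x \<in> X \<Longrightarrow> y \<in> X \<Longrightarrow> N (\<lambda>k. x k + y k) \<le> N x + N y"
  using lattice unfolding banach_seq_lattice_def by (elim conjE) blast

lemma N_scale: "x \<in> X \<Longrightarrow> N (\<lambda>k. c * x k) = \<bar>c\<bar> * N x"
  using lattice unfolding banach_seq_lattice_def by (elim conjE) blast

lemma solid: 
  assumes "x \<in> X" "\<And>k. \<bar>y k\<bar> \<le> \<bar>x k\<bar>"
  shows "y \<in> X" "N y \<le> N x"
proof -
  have *: "\<forall>x\<in>X. \<forall>y. (\<forall>k. \<bar>y k\<bar> \<le> \<bar>x k\<bar>) \<longrightarrow> y \<in> X \<and> N y \<le> N x"
    using lattice unfolding banach_seq_lattice_def by (elim conjE)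
  show "y \<in> X" "N y \<le> N x" using * assms by auto
qed

lemma bounded_X: "x \<in> X \<Longrightarrow> bounded (range x)"
  using sym by (simp add: symmetric_seq_space_def)

lemma eqdist_in:
  assumes "x \<in> X" "eqdist y x"
  shows "y \<in> X" "N y = N x"
proof -
  have "bounded (range y)"
    using assms bounded_X eqdist_bounded eqdist_sym by blast
  then show "y \<in> X" "N y = N x"
    using sym assms(1) eqdist_decr_rearr[OF assms(2)] unfolding symmetric_seq_space_def by blast+
qed

lemma N_zero: "N (\<lambda>k. 0) = 0"
  using N_eq_0 zero_in by blast

lemma N_pos: "x \<in> X \<Longrightarrow> x \<noteq> (\<lambda>k. 0) \<Longrightarrow> 0 < N x"
  using N_eq_0 N_nonneg by (metis less_eq_real_def)

lemma diff_in: "x \<in> X \<Longrightarrow> y \<in> X \<Longrightarrow> (\<lambda>k. x k - y k) \<in> X"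
  using add_in[OF _ scale_in[of y "-1"], of x] by simp

lemma N_diff: "x \<in> X \<Longrightarrow> y \<in> X \<Longrightarrow> N (\<lambda>k. x k - y k) \<le> N x + N y"
  using N_add[OF _ scale_in[of y "-1"], of x] N_scale[of y "-1"] by simp

lemma N_reverse: "x \<in> X \<Longrightarrow> y \<in> X \<Longrightarrow> \<bar>N x - N y\<bar> \<le> N (\<lambda>k. x k - y k)"
  using N_add[OF diff_in[of x y], of y] N_add[OF diff_in[of y x], of x]
    N_scale[OF diff_in[of y x], of "-1"]
  by (auto simp: abs_le_iff)

lemma sum_in:
  assumes "finite I" "\<And>i. i \<in> I \<Longrightarrow> y i \<in> X"
  shows "(\<lambda>k. \<Sum>i\<in>I. y i k) \<in> X" "N (\<lambda>k. \<Sum>i\<in>I. y i k) \<le> (\<Sum>i\<in>I. N (y i))"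
proof -
  have "(\<lambda>k. \<Sum>i\<in>I. y i k) \<in> X \<and> N (\<lambda>k. \<Sum>i\<in>I. y i k) \<le> (\<Sum>i\<in>I. N (y i))"
    using assms
  proof (induction I rule: finite_induct)
    case empty
    then show ?case by (simp add: zero_in N_zero)
  next
    case (insert i I)
    have "N (\<lambda>k. y i k + (\<Sum>i\<in>I. y i k)) \<le> N (y i) + N (\<lambda>k. \<Sum>i\<in>I. y i k)"
      using insert by (intro N_add) auto
    moreover have "(\<lambda>k. y i k + (\<Sum>i\<in>I. y i k)) \<in> X"
      using insert by (intro add_in) auto
    ultimately show ?case using insert by auto
  qed
  then show "(\<lambda>k. \<Sum>i\<in>I. y i k) \<in> X" "N (\<lambda>k. \<Sum>i\<in>I. y i k) \<le> (\<Sum>i\<in>I. N (y i))" by auto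
qed

lemma spread_in:
  assumes "x \<in> X" "i < n"
  shows "spread n i x \<in> X" "N (spread n i x) = N x"
  using eqdist_in[OF assms(1) eqdist_spread[OF assms(2)]] by auto

lemma interleave_in:
  assumes "0 < n" "\<And>i. i < n \<Longrightarrow> y i \<in> X"
  shows "interleave n y \<in> X" "N (interleave n y) \<le> (\<Sum>i<n. N (y i))"
proof -
  have *: "(\<Sum>i<n. N (spread n i (y i))) = (\<Sum>i<n. N (y i))"
    using assms spread_in by (intro sum.cong) auto
  show "interleave n y \<in> X"
    unfolding interleave_spread[OF assms(1)] by (rule sum_in) (use assms spread_in in auto)
  show "N (interleave n y) \<le> (\<Sum>i<n. N (y i))"
    unfolding interleave_spread[OF assms(1)] *[symmetric] by (rule sum_in) (use assms spread_in in auto)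
qed

lemma dil_up_in:
  assumes "0 < m" "x \<in> X"
  shows "dil_up m x \<in> X" "N (dil_up m x) \<le> real m * N x"
  using interleave_in[OF assms(1), of "\<lambda>_. x"] assms(2) by (auto simp: dil_up_interleave)

text \<open>A copy of \<open>x\<close> on the multiples of \<open>m\<close> lies below
  \<open>dil_up m x\<close>. The membership half is what later puts \<open>dil_down m x\<close> into
  X.\<close>

lemma dil_up_inD:
  assumes "0 < m" "dil_up m x \<in> X"
  shows "x \<in> X" "N x \<le> N (dil_up m x)"
proof -
  have *: "\<And>k. \<bar>spread m 0 x k\<bar> \<le> \<bar>dil_up m x k\<bar>"
    by (auto simp: spread_def dil_up_def)
  have e: "eqdist x (spread m 0 x)" by (rule eqdist_sym[OF eqdist_spread[OF assms(1)]])
  show "x \<in> X" "N x \<le> N (dil_up m x)"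
    using eqdist_in[OF solid(1)[OF assms(2) *] e] solid(2)[OF assms(2) *] by auto
qed

text \<open>A larger dilation reads an earlier entry, which is a larger one only if the sequence
  decreases; hence the passage to the rearrangement.\<close>

lemma dil_up_mono_N:
  assumes "0 < m" "m \<le> n" "x \<in> X"
  shows "N (dil_up m x) \<le> N (dil_up n x)"
proof -
  define y where "y = decr_rearr x"
  have e: "eqdist y x" using bounded_X[OF assms(3)] by (simp add: y_def eqdist_decr_rearr_self)
  then have y: "y \<in> X" using eqdist_in assms by blast
  have *: "\<bar>dil_up m y k\<bar> \<le> \<bar>dil_up n y k\<bar>" for k
    using assms bounded_X[OF assms(3)]
    by (auto simp: dil_up_def y_def abs_of_nonneg decr_rearr_nonneg intro!: decr_rearr_antimono div_le_mono2)
  have "N (dil_up l x) = N (dil_up l y)" if "0 < l" for l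
    using eqdist_in(2)[OF dil_up_in(1) eqdist_dil_up] that e y assms eqdist_sym by metis
  moreover have "N (dil_up m y) \<le> N (dil_up n y)"
    using assms y * by (intro solid(2) dil_up_in) auto
  ultimately show ?thesis using assms by simp
qed

end

section \<open>Dilation identities and block averaging\<close>

lemma dil_up_dil_up: "dil_up m (dil_up n x) = dil_up (m * n) x"
  by (simp add: dil_up_def div_mult2_eq)

lemma dil_up_1: "dil_up 1 x = x" "dil_up (Suc 0) x = x"
  by (simp_all add: dil_up_def)

lemma dil_down_dil_up: "0 < m \<Longrightarrow> dil_down m (dil_up m x) = x"
proof
  fix n assume m: "0 < m"
  have "(\<Sum>k = n * m..<n * m + m. dil_up m x k) = (\<Sum>k = n * m..<n * m + m. x n)"
  proof (rule sum.cong)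
    fix k assume k: "k \<in> {n * m..<n * m + m}"
    then have "k div m = n"
      by (intro div_nat_eqI) (auto simp: algebra_simps)
    then show "dil_up m x k = x n" by (simp add: dil_up_def)
  qed simp
  then show "dil_down m (dil_up m x) n = x n"
    using m by (simp add: dil_down_def)
qed

text \<open>Block averaging is the mean of the cyclic shifts within blocks, hence a contraction for any
  rearrangement invariant norm.\<close>

definition block_shift :: "nat \<Rightarrow> nat \<Rightarrow> nat \<Rightarrow> nat" where
  "block_shift m r k = (k div m) * m + (k mod m + r) mod m"

lemma bij_mod_add:
  assumes "0 < m"
  shows "bij_betw (\<lambda>s::nat. (s + r) mod m) {..<m} {..<m}"
proof -
  let ?f = "\<lambda>s. (s + r) mod m"
  have "{..<m} \<subseteq> ?f ` {..<m}"
  proof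
    fix u assume u: "u \<in> {..<m}"
    \<comment> \<open>\<open>m * r - r\<close> stands for \<open>-r\<close> modulo \<open>m\<close>
      without leaving the natural numbers; it is a true difference because
      \<open>m > 0\<close>.\<close>
    have "?f ((u + (m * r - r)) mod m) = (u + (m * r - r) + r) mod m"
      by (rule mod_add_left_eq)
    also have "u + (m * r - r) + r = u + m * r" using assms by (cases m) auto
    also have "(u + m * r) mod m = u" using u by simp
    finally show "u \<in> ?f ` {..<m}" using assms by (intro image_eqI[of _ _ "(u + (m * r - r)) mod m"]) auto
  qed
  moreover from this have "inj_on ?f {..<m}" by (intro finite_surj_inj) auto
  moreover have "?f ` {..<m} \<subseteq> {..<m}" using assms by auto
  ultimately show ?thesis
    by (simp add: bij_betw_def)
qed

lemma bij_block_shift: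
  assumes "0 < m"
  shows "bij (block_shift m r)"
proof (rule bijI)
  note b = bij_mod_add[OF assms, of r]
  have dm: "block_shift m r k div m = k div m" "block_shift m r k mod m = (k mod m + r) mod m" for k
    using assms by (auto simp: block_shift_def)
  show "inj (block_shift m r)"
  proof (rule injI)
    fix k l assume eq: "block_shift m r k = block_shift m r l"
    then have "k div m = l div m" "(k mod m + r) mod m = (l mod m + r) mod m"
      using dm by metis+
    moreover from this have "k mod m = l mod m"
      using inj_onD[OF bij_betw_imp_inj_on[OF b], of "k mod m" "l mod m"] assms by simp
    ultimately show "k = l" by (metis div_mult_mod_eq)
  qed
  show "surj (block_shift m r)"
  proof (rule surjI)
    fix k
    have "k mod m \<in> (\<lambda>s. (s + r) mod m) ` {..<m}"
      using b assms by (simp add: bij_betw_def)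
    then have "\<exists>s<m. (s + r) mod m = k mod m" by auto
    define s where "s = (SOME s. s < m \<and> (s + r) mod m = k mod m)"
    have s: "s < m \<and> (s + r) mod m = k mod m"
      unfolding s_def by (rule someI_ex) fact
    show "block_shift m r ((k div m) * m + (SOME s. s < m \<and> (s + r) mod m = k mod m)) = k"
      using s by (simp add: s_def[symmetric] block_shift_def)
  qed
qed

lemma block_average:
  assumes "0 < m"
  shows "dil_up m (dil_down m x) k = (1 / real m) * (\<Sum>r<m. x (block_shift m r k))"
proof -
  define q s where "q = k div m" and "s = k mod m"
  have "(\<Sum>r<m. x (block_shift m r k)) = (\<Sum>r<m. x (q * m + (r + s) mod m))"
    by (simp add: block_shift_def q_def s_def add.commute)
  also have "\<dots> = (\<Sum>r<m. x (q * m + r))"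
    using sum.reindex_bij_betw[OF bij_mod_add[OF assms, of s], of "\<lambda>r. x (q * m + r)"] by simp
  also have "\<dots> = (\<Sum>i = q * m..<q * m + m. x i)"
    by (simp add: sum.shift_bounds_nat_ivl[of x 0 "q*m" m, simplified] lessThan_atLeast0 add.commute)
  finally show ?thesis
    by (simp add: dil_up_def dil_down_def q_def)
qed

context sym_space
begin

lemma dil_down_in:
  assumes "0 < m" "x \<in> X"
  shows "dil_down m x \<in> X" "N (dil_up m (dil_down m x)) \<le> N x"
proof -
  have s: "(\<lambda>k. x (block_shift m r k)) \<in> X" "N (\<lambda>k. x (block_shift m r k)) = N x" for r
    using eqdist_in[OF assms(2) eqdist_comp_bij[OF bij_block_shift[OF assms(1)]]] by auto
  note S = sum_in[of "{..<m}" "\<lambda>r k. x (block_shift m r k)"]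
  have eq: "dil_up m (dil_down m x) = (\<lambda>k. (1 / real m) * (\<Sum>r<m. x (block_shift m r k)))"
    using block_average[OF assms(1)] by blast
  have "dil_up m (dil_down m x) \<in> X"
    unfolding eq using s by (intro scale_in S) auto
  then show "dil_down m x \<in> X" using dil_up_inD assms by blast
  have "N (dil_up m (dil_down m x)) = (1 / real m) * N (\<lambda>k. \<Sum>r<m. x (block_shift m r k))"
    unfolding eq using s S by (subst N_scale) auto
  also have "\<dots> \<le> (1 / real m) * (\<Sum>r<m. N x)"
    using S s by (intro mult_left_mono) auto
  finally show "N (dil_up m (dil_down m x)) \<le> N x" using assms by simp
qed

end

section \<open>Growth of dilations and the Boyd indices\<close>

text \<open>The hypothesis is shaped to serve both growth factors. For
  \<open>ln (upper_growth n)\<close> one passes to the power \<open>m ^ (k + 1)\<close> above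
  \<open>n\<close>, and the additional \<open>F m\<close> goes into \<open>c m\<close>; for
  \<open>- ln (lower_growth n)\<close> the power below \<open>n\<close> is used and
  \<open>c m = 0\<close>. The lower bound keeps the infimum \<open>L\<close> of the quotients
  finite.\<close>

lemma multiplicative_fekete:
  fixes F c :: "nat \<Rightarrow> real"
  assumes sub: "\<And>m n k. 2 \<le> m \<Longrightarrow> m ^ k \<le> n \<Longrightarrow> n < m ^ (k + 1) \<Longrightarrow> F n \<le> real k * F m + c m"
    and lower: "\<And>n. 2 \<le> n \<Longrightarrow> - B * ln (real n) \<le> F n"
  obtains L where "(\<lambda>n. F n / ln (real n)) \<longlonglongrightarrow> L"
    and "\<And>n. 2 \<le> n \<Longrightarrow> L * ln (real n) \<le> F n"
proof -
  define a where "a n = F n / ln (real n)" for n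
  define L where "L = (INF n\<in>{2..}. a n)"
  have pos: "0 < ln (real n)" if "2 \<le> n" for n :: nat using that by simp
  have "- B \<le> a n" if "2 \<le> n" for n
    using lower[OF that] pos[OF that] by (simp add: a_def field_simps)
  then have bdd: "bdd_below (a ` {2..})" by (auto intro!: bdd_belowI[of _ "- B"])
  have L_le: "L \<le> a n" if "2 \<le> n" for n
    unfolding L_def using bdd that by (intro cINF_lower) auto
  have "a \<longlonglongrightarrow> L"
  proof (rule LIMSEQ_I)
    fix e :: real assume e: "0 < e"
    have "\<exists>m\<in>{2..}. a m < L + e / 2"
      using e bdd cINF_less_iff[of "{2..}" a "L + e / 2"] by (auto simp: L_def)
    then obtain m where m: "2 \<le> m" "a m < L + e / 2" by auto
    define d where "d = \<bar>F m\<bar> + \<bar>c m\<bar>"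
    have key: "a n \<le> a m + d / ln (real n)" if n: "2 \<le> n" for n
    proof -
      obtain k where k: "m ^ k \<le> n" "n < m ^ (k + 1)"
        using ex_power_ivl1[of m n] m(1) n by auto
      have "real (m ^ k) \<le> real n" "real n \<le> real (m ^ (k + 1))"
        using k by (simp_all only: of_nat_le_iff less_imp_le)
      then have "ln (real m ^ k) \<le> ln (real n)" "ln (real n) \<le> ln (real m ^ (k + 1))"
        using n m by (subst ln_le_cancel_iff; simp)+
      then have kl: "real k * ln (real m) \<le> ln (real n)" "ln (real n) \<le> real (k + 1) * ln (real m)"
        using m by (simp_all only: ln_realpow)
      \<comment> \<open>Exchanging \<open>k\<close> for \<open>ln n / ln m\<close> costs at most
        \<open>\<bar>F m\<bar>\<close>; the absolute value is needed because \<open>F m\<close> may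
        have either sign.\<close>
      have "\<bar>real k - ln (real n) / ln (real m)\<bar> \<le> 1"
        using kl pos[OF m(1)] by (simp add: abs_le_iff field_simps)
      then have "\<bar>(real k - ln (real n) / ln (real m)) * F m\<bar> \<le> 1 * \<bar>F m\<bar>"
        unfolding abs_mult by (intro mult_right_mono) auto
      then have "real k * F m \<le> ln (real n) / ln (real m) * F m + \<bar>F m\<bar>"
        by (simp add: abs_le_iff algebra_simps)
      then have "F n \<le> ln (real n) / ln (real m) * F m + d"
        using sub[OF m(1) k] by (simp add: d_def)
      then have "F n / ln (real n) \<le> (ln (real n) / ln (real m) * F m + d) / ln (real n)"
        using pos[OF n] by (intro divide_right_mono) auto
      then show ?thesis
        using pos[OF n] by (simp add: a_def add_divide_distrib)
    qed
    have "((\<lambda>n. d / ln (real n)) \<longlongrightarrow> 0) sequentially" by real_asymp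
    then have "eventually (\<lambda>n. d / ln (real n) < e / 2) sequentially"
      using e by (intro order_tendstoD(2)) auto
    then obtain n0 where n0: "\<And>n. n0 \<le> n \<Longrightarrow> d / ln (real n) < e / 2"
      by (auto simp: eventually_sequentially)
    show "\<exists>no. \<forall>n\<ge>no. norm (a n - L) < e"
    proof (intro exI allI impI)
      fix n assume n: "max 2 n0 \<le> n"
      then have "a n \<le> a m + d / ln (real n)" "d / ln (real n) < e / 2"
        using key[of n] n0[of n] by simp_all
      then have "a n < L + e" using m(2) by linarith
      moreover have "L \<le> a n" using L_le n by simp
      ultimately show "norm (a n - L) < e" by simp
    qed
  qed
  moreover have "L * ln (real n) \<le> F n" if "2 \<le> n" for n
    using L_le[OF that] pos[OF that] by (simp add: a_def field_simps)
  ultimately show ?thesis using that unfolding a_def by blast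
qed

locale nontrivial_sym_space = sym_space +
  assumes nontrivial: "\<exists>x\<in>X. x \<noteq> (\<lambda>k. 0)"
begin

definition decreasing :: "(nat \<Rightarrow> real) \<Rightarrow> bool" where
  "decreasing x \<longleftrightarrow> x \<in> X \<and> (\<forall>k. 0 \<le> x k) \<and> (\<forall>k l. k \<le> l \<longrightarrow> x l \<le> x k)"

lemma decreasing_in: "decreasing x \<Longrightarrow> x \<in> X"
  by (simp add: decreasing_def)

lemma decreasing_nonneg: "decreasing x \<Longrightarrow> 0 \<le> x k"
  by (simp add: decreasing_def)

lemma decreasing_dil_up: "decreasing x \<Longrightarrow> 0 < m \<Longrightarrow> decreasing (dil_up m x)"
  using dil_up_in by (auto simp: decreasing_def dil_up_def div_le_mono)

lemma decreasing_scale: "decreasing x \<Longrightarrow> 0 \<le> c \<Longrightarrow> decreasing (\<lambda>k. c * x k)"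
  using scale_in by (auto simp: decreasing_def intro: mult_left_mono)

lemma decreasing_sum:
  assumes "finite I" "\<And>i. i \<in> I \<Longrightarrow> decreasing (y i)"
  shows "decreasing (\<lambda>k. \<Sum>i\<in>I. y i k)"
  using assms sum_in(1)[of I y] by (auto simp: decreasing_def intro!: sum_nonneg sum_mono)

lemma rearrangement:
  assumes "x \<in> X"
  obtains y where "decreasing y" "N y = N x" "\<And>m. 0 < m \<Longrightarrow> N (dil_up m y) = N (dil_up m x)"
proof -
  define y where "y = decr_rearr x"
  have e: "eqdist y x" using bounded_X[OF assms] by (simp add: y_def eqdist_decr_rearr_self)
  have "decreasing y" "N y = N x"
    using eqdist_in[OF assms e] bounded_X[OF assms]
    by (auto simp: decreasing_def y_def decr_rearr_nonneg decr_rearr_antimono)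
  moreover have "N (dil_up m y) = N (dil_up m x)" if "0 < m" for m
    using eqdist_in(2)[OF dil_up_in(1)[OF that assms] eqdist_dil_up[OF that e]] .
  ultimately show ?thesis using that by blast
qed

lemma N_mono: 
  assumes "decreasing y" "\<And>k. 0 \<le> x k" "\<And>k. x k \<le> y k"
  shows "N x \<le> N y"
  using assms by (intro solid(2)) (auto simp: decreasing_in decreasing_nonneg)

section \<open>Operator norms and the two growth factors\<close>

lemma op_norm_bound:
  assumes hom: "\<And>c x. T (\<lambda>k. c * x k) = (\<lambda>k. c * T x k)"
    and T: "\<And>x. x \<in> X \<Longrightarrow> T x \<in> X" "\<And>x. x \<in> X \<Longrightarrow> N (T x) \<le> B * N x"
    and x: "x \<in> X"
  shows "N (T x) \<le> op_norm X N T * N x"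
proof (cases "N x = 0")
  case True
  then show ?thesis using T(2)[OF x] by simp
next
  case False
  then have pos: "0 < N x" using N_nonneg[OF x] by simp
  define y where "y = (\<lambda>k. (1 / N x) * x k)"
  have y: "y \<in> X" "N y = 1"
    using scale_in[OF x, of "1 / N x"] N_scale[OF x, of "1 / N x"] pos by (simp_all add: y_def)
  \<comment> \<open>A real \<open>SUP\<close> over an unbounded set carries no information, so the a
    priori constant \<open>B\<close> is what gives \<open>op_norm\<close> a meaning. Its sign is
    unknown, hence \<open>\<bar>B\<bar>\<close>.\<close>
  have bdd: "bdd_above ((\<lambda>x. N (T x)) ` {x \<in> X. N x \<le> 1})"
  proof (rule bdd_aboveI2)
    fix z assume z: "z \<in> {x \<in> X. N x \<le> 1}"
    then have "N (T z) \<le> B * N z" using T by auto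
    also have "\<dots> \<le> \<bar>B\<bar> * 1" using z N_nonneg by (intro mult_mono) auto
    finally show "N (T z) \<le> \<bar>B\<bar>" by simp
  qed
  have "N (T y) = N (T x) / N x"
    unfolding y_def hom using N_scale[OF T(1)[OF x], of "1 / N x"] pos by simp
  moreover have "N (T y) \<le> op_norm X N T"
    unfolding op_norm_def using bdd y by (intro cSUP_upper) auto
  ultimately have "N (T x) / N x \<le> op_norm X N T" by simp
  then show ?thesis using pos by (simp only: pos_divide_le_eq)
qed

lemma op_norm_least:
  assumes "\<And>x. x \<in> X \<Longrightarrow> N (T x) \<le> c * N x" "0 \<le> c"
  shows "op_norm X N T \<le> c"
  unfolding op_norm_def
proof (rule cSUP_least)
  show "{x \<in> X. N x \<le> 1} \<noteq> {}" using zero_in N_zero by auto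
  fix x assume x: "x \<in> {x \<in> X. N x \<le> 1}"
  then have "N (T x) \<le> c * N x" using assms by auto
  also have "\<dots> \<le> c * 1" using x assms by (intro mult_left_mono) auto
  finally show "N (T x) \<le> c" by simp
qed

definition upper_growth :: "nat \<Rightarrow> real" where
  "upper_growth m = op_norm X N (dil_up m)"

definition lower_growth :: "nat \<Rightarrow> real" where
  "lower_growth m = 1 / op_norm X N (dil_down m)"

lemma upper_growth_bound:
  assumes "0 < m" "x \<in> X"
  shows "N (dil_up m x) \<le> upper_growth m * N x"
  unfolding upper_growth_def
  by (rule op_norm_bound[where B = "real m"]) (use assms dil_up_in in \<open>auto simp: dil_up_def\<close>)

lemma upper_growth_least:
  assumes "0 < m" "0 \<le> c" "\<And>x. decreasing x \<Longrightarrow> N (dil_up m x) \<le> c * N x"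
  shows "upper_growth m \<le> c"
  unfolding upper_growth_def
  by (rule op_norm_least) (use assms rearrangement in metis)+

lemma dil_down_bound:
  assumes "0 < m" "x \<in> X"
  shows "N (dil_down m x) \<le> op_norm X N (dil_down m) * N x"
proof (rule op_norm_bound[where B = 1])
  show "\<And>c x. dil_down m (\<lambda>k. c * x k) = (\<lambda>k. c * dil_down m x k)"
    by (simp add: dil_down_def sum_distrib_left[symmetric])
  show "\<And>x. x \<in> X \<Longrightarrow> N (dil_down m x) \<le> 1 * N x"
    using dil_up_inD(2) dil_up_in(1) dil_down_in assms(1) by (metis mult_1 order_trans)
qed (use assms dil_down_in in auto)

lemma nonzero_decreasing:
  obtains x where "decreasing x" "0 < N x"
proof -
  obtain x where "x \<in> X" "x \<noteq> (\<lambda>k. 0)" using nontrivial by blast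
  then have "x \<in> X" "0 < N x" using N_pos by auto
  then show ?thesis using rearrangement that by metis
qed

text \<open>Nontriviality of the space enters here: with norm 0, \<open>lower_growth m\<close> would
  be the default value \<open>1 / 0 = 0\<close>.\<close>

lemma op_norm_dil_down_pos:
  assumes "0 < m"
  shows "0 < op_norm X N (dil_down m)"
proof -
  obtain x where x: "decreasing x" "0 < N x" by (rule nonzero_decreasing)
  have "0 < op_norm X N (dil_down m) * N (dil_up m x)"
    using dil_down_bound[OF assms dil_up_in(1)[OF assms decreasing_in[OF x(1)]]] x(2)
    by (simp add: dil_down_dil_up assms)
  then show ?thesis
    using N_nonneg[OF dil_up_in(1)[OF assms decreasing_in[OF x(1)]]] by (simp add: zero_less_mult_iff)
qed

lemma lower_growth_bound:
  assumes "0 < m" "x \<in> X"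
  shows "lower_growth m * N x \<le> N (dil_up m x)"
  using dil_down_bound[OF assms(1) dil_up_in(1)[OF assms]] op_norm_dil_down_pos[OF assms(1)]
  by (simp add: dil_down_dil_up assms lower_growth_def field_simps)

text \<open>Apply the hypothesis to a rearrangement of \<open>dil_down m x\<close>. Contractivity of
  block averaging then bounds the norm of \<open>dil_down m\<close> by \<open>1 / c\<close>.\<close>

lemma lower_growth_greatest:
  assumes "0 < m" "0 < c" "\<And>x. decreasing x \<Longrightarrow> c * N x \<le> N (dil_up m x)"
  shows "c \<le> lower_growth m"
proof -
  have "op_norm X N (dil_down m) \<le> 1 / c"
  proof (rule op_norm_least)
    fix x assume x: "x \<in> X"
    obtain y where "decreasing y" "N y = N (dil_down m x)" 
      "\<And>l. 0 < l \<Longrightarrow> N (dil_up l y) = N (dil_up l (dil_down m x))"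
      using rearrangement[OF dil_down_in(1)[OF assms(1) x]] by metis
    then have "c * N (dil_down m x) \<le> N x"
      using assms(3)[of y] dil_down_in(2)[OF assms(1) x] assms(1) by simp
    then show "N (dil_down m x) \<le> 1 / c * N x" using assms(2) by (simp add: field_simps)
  qed (use assms in auto)
  then show ?thesis
    using op_norm_dil_down_pos[OF assms(1)] assms(2) by (simp add: lower_growth_def field_simps)
qed

lemma lower_growth_ge_1:
  assumes "0 < m"
  shows "1 \<le> lower_growth m"
proof (rule lower_growth_greatest[OF assms])
  fix x assume "decreasing x"
  then show "1 * N x \<le> N (dil_up m x)"
    using dil_up_inD(2)[OF assms dil_up_in(1)[OF assms decreasing_in]] by simp
qed simp

lemma lower_le_upper_growth:
  assumes "0 < m"
  shows "lower_growth m \<le> upper_growth m"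
proof -
  obtain x where x: "decreasing x" "0 < N x" by (rule nonzero_decreasing)
  have "lower_growth m * N x \<le> upper_growth m * N x"
    using lower_growth_bound upper_growth_bound assms decreasing_in[OF x(1)] order_trans by blast
  then show ?thesis using x(2) by simp
qed

lemma upper_growth_le: "0 < m \<Longrightarrow> upper_growth m \<le> real m"
  using upper_growth_least[of m "real m"] dil_up_in(2) decreasing_in by simp

lemma upper_growth_ge_1: "0 < m \<Longrightarrow> 1 \<le> upper_growth m"
  using lower_growth_ge_1 lower_le_upper_growth order_trans by blast

lemma upper_growth_mult:
  assumes "0 < m" "0 < n"
  shows "upper_growth (m * n) \<le> upper_growth m * upper_growth n"
proof (rule upper_growth_least)
  fix x assume "decreasing x"
  then have x: "x \<in> X" by (rule decreasing_in)
  have "N (dil_up (m * n) x) \<le> upper_growth m * N (dil_up n x)"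
    using upper_growth_bound[OF assms(1) dil_up_in(1)[OF assms(2) x]] by (simp add: dil_up_dil_up)
  also have "\<dots> \<le> upper_growth m * (upper_growth n * N x)"
    using upper_growth_bound[OF assms(2) x] upper_growth_ge_1[OF assms(1)] by (intro mult_left_mono) auto
  finally show "N (dil_up (m * n) x) \<le> upper_growth m * upper_growth n * N x"
    by (simp add: mult.assoc)
qed (use assms upper_growth_ge_1[OF assms(1)] upper_growth_ge_1[OF assms(2)] in auto)

lemma lower_growth_mult:
  assumes "0 < m" "0 < n"
  shows "lower_growth m * lower_growth n \<le> lower_growth (m * n)"
proof (rule lower_growth_greatest)
  fix x assume "decreasing x"
  then have x: "x \<in> X" by (rule decreasing_in)
  have "lower_growth m * (lower_growth n * N x) \<le> lower_growth m * N (dil_up n x)"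
    using lower_growth_bound[OF assms(2) x] lower_growth_ge_1[OF assms(1)] by (intro mult_left_mono) auto
  also have "\<dots> \<le> N (dil_up (m * n) x)"
    using lower_growth_bound[OF assms(1) dil_up_in(1)[OF assms(2) x]] by (simp add: dil_up_dil_up)
  finally show "lower_growth m * lower_growth n * N x \<le> N (dil_up (m * n) x)"
    by (simp add: mult.assoc)
qed (use assms lower_growth_ge_1[OF assms(1)] lower_growth_ge_1[OF assms(2)] in \<open>auto intro!: mult_pos_pos\<close>)

lemma upper_growth_mono:
  assumes "0 < m" "m \<le> n"
  shows "upper_growth m \<le> upper_growth n"
proof (rule upper_growth_least)
  fix x assume "decreasing x"
  then have x: "x \<in> X" by (rule decreasing_in)
  show "N (dil_up m x) \<le> upper_growth n * N x"
    using dil_up_mono_N[OF assms x] upper_growth_bound[of n x] assms x by simp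
qed (use assms upper_growth_ge_1[of n] in auto)

lemma lower_growth_mono:
  assumes "0 < m" "m \<le> n"
  shows "lower_growth m \<le> lower_growth n"
proof (rule lower_growth_greatest)
  fix x assume "decreasing x"
  then have x: "x \<in> X" by (rule decreasing_in)
  show "lower_growth m * N x \<le> N (dil_up n x)"
    using dil_up_mono_N[OF assms x] lower_growth_bound[of m x] assms x by simp
qed (use assms lower_growth_ge_1[of m] in auto)

lemma upper_growth_power: "0 < m \<Longrightarrow> upper_growth (m ^ k) \<le> upper_growth m ^ k"
proof (induction k)
  case 0
  then show ?case using upper_growth_le[of 1] by simp
next
  case (Suc k)
  have "upper_growth (m ^ Suc k) \<le> upper_growth m * upper_growth (m ^ k)"
    using upper_growth_mult[of m "m ^ k"] Suc by simp
  also have "\<dots> \<le> upper_growth m * upper_growth m ^ k"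
    using Suc upper_growth_ge_1[of m] by (intro mult_left_mono) auto
  finally show ?case by simp
qed

lemma lower_growth_power: "0 < m \<Longrightarrow> lower_growth m ^ k \<le> lower_growth (m ^ k)"
proof (induction k)
  case 0
  then show ?case using lower_growth_ge_1[of 1] by simp
next
  case (Suc k)
  have "lower_growth m * lower_growth m ^ k \<le> lower_growth m * lower_growth (m ^ k)"
    using Suc lower_growth_ge_1[of m] by (intro mult_left_mono) auto
  also have "\<dots> \<le> lower_growth (m ^ Suc k)"
    using lower_growth_mult[of m "m ^ k"] Suc by simp
  finally show ?case by simp
qed

section \<open>The Boyd indices as limits and as one-sided bounds\<close>

lemma upper_growth_limit:
  shows "(\<lambda>m. ln (upper_growth m) / ln (real m)) \<longlonglongrightarrow> boyd_beta X N"
    and "\<And>m. 0 < m \<Longrightarrow> real m powr boyd_beta X N \<le> upper_growth m"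
proof -
  obtain L where L: "(\<lambda>m. ln (upper_growth m) / ln (real m)) \<longlonglongrightarrow> L"
    "\<And>m. 2 \<le> m \<Longrightarrow> L * ln (real m) \<le> ln (upper_growth m)"
  proof (rule multiplicative_fekete[of "\<lambda>m. ln (upper_growth m)" "\<lambda>m. ln (upper_growth m)" 0])
    fix m n k :: nat assume m: "2 \<le> m" "m ^ k \<le> n" "n < m ^ (k + 1)"
    then have n: "0 < n" by (metis gr0I le_zero_eq power_not_zero not_numeral_le_zero)
    have "upper_growth n \<le> upper_growth (m ^ (k + 1))" using m n by (intro upper_growth_mono) auto
    also have "\<dots> \<le> upper_growth m ^ (k + 1)" using m by (intro upper_growth_power) auto
    finally have "ln (upper_growth n) \<le> ln (upper_growth m ^ (k + 1))"
      using upper_growth_ge_1[OF n] by (intro ln_mono) auto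
    also have "\<dots> = real (k + 1) * ln (upper_growth m)"
      by (rule ln_realpow)
    finally show "ln (upper_growth n) \<le> real k * ln (upper_growth m) + ln (upper_growth m)"
      by (simp add: algebra_simps)
  next
    fix n :: nat assume "2 \<le> n"
    then show "- 0 * ln (real n) \<le> ln (upper_growth n)" using upper_growth_ge_1[of n] by simp
  qed blast
  have "(\<lambda>m. log 2 (op_norm X N (dil_up m)) / log 2 (real m)) \<longlonglongrightarrow> L"
    using L(1) by (simp add: log_def upper_growth_def)
  \<comment> \<open>The index is defined through \<open>lim\<close>, which says something only once
    convergence is known. The base of the logarithms cancels in the quotient.\<close>
  then have [simp]: "boyd_beta X N = L" by (simp add: boyd_beta_def limI)
  show "(\<lambda>m. ln (upper_growth m) / ln (real m)) \<longlonglongrightarrow> boyd_beta X N" using L(1) by simp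
  fix m :: nat assume m: "0 < m"
  show "real m powr boyd_beta X N \<le> upper_growth m"
  proof (cases "m = 1")
    case True
    then show ?thesis using upper_growth_ge_1[of 1] by simp
  next
    case False
    then have "ln (real m powr L) \<le> ln (upper_growth m)"
      using L(2)[of m] m by (simp add: ln_powr)
    then show ?thesis using upper_growth_ge_1[OF m] m by (subst (asm) ln_le_cancel_iff) auto
  qed
qed

lemma lower_growth_limit:
  shows "(\<lambda>m. ln (lower_growth m) / ln (real m)) \<longlonglongrightarrow> boyd_alpha X N"
    and "\<And>m. 0 < m \<Longrightarrow> lower_growth m \<le> real m powr boyd_alpha X N"
proof -
  obtain L where L: "(\<lambda>m. - ln (lower_growth m) / ln (real m)) \<longlonglongrightarrow> L"
    "\<And>m. 2 \<le> m \<Longrightarrow> L * ln (real m) \<le> - ln (lower_growth m)"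
  proof (rule multiplicative_fekete[of "\<lambda>m. - ln (lower_growth m)" "\<lambda>m. 0" 1])
    fix m n k :: nat assume m: "2 \<le> m" "m ^ k \<le> n" "n < m ^ (k + 1)"
    have "lower_growth m ^ k \<le> lower_growth (m ^ k)" using m by (intro lower_growth_power) auto
    also have "\<dots> \<le> lower_growth n" using m by (intro lower_growth_mono) auto
    finally have "ln (lower_growth m ^ k) \<le> ln (lower_growth n)"
      using lower_growth_ge_1[of m] m by (intro ln_mono) (auto intro: zero_less_power)
    then show "- ln (lower_growth n) \<le> real k * - ln (lower_growth m) + 0"
      by (simp add: ln_realpow)
  next
    fix n :: nat assume n: "2 \<le> n"
    then have "lower_growth n \<le> real n"
      using lower_le_upper_growth[of n] upper_growth_le[of n] by simp
    then show "- 1 * ln (real n) \<le> - ln (lower_growth n)" using lower_growth_ge_1[of n] n by simp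
  qed blast
  have "ln (op_norm X N (dil_down m)) = - ln (lower_growth m)" if "0 < m" for m
    using op_norm_dil_down_pos[OF that] by (simp add: lower_growth_def ln_div)
  then have "eventually (\<lambda>m. - ln (lower_growth m) / ln (real m) =
      log 2 (op_norm X N (dil_down m)) / log 2 (real m)) sequentially"
    by (intro eventually_mono[OF eventually_gt_at_top[of 0]]) (simp add: log_def)
  then have "(\<lambda>m. log 2 (op_norm X N (dil_down m)) / log 2 (real m)) \<longlonglongrightarrow> L"
    using L(1) by (rule Lim_transform_eventually[rotated])
  then have [simp]: "boyd_alpha X N = - L" by (simp add: boyd_alpha_def limI)
  show "(\<lambda>m. ln (lower_growth m) / ln (real m)) \<longlonglongrightarrow> boyd_alpha X N"
    using tendsto_minus[OF L(1)] by simp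
  fix m :: nat assume m: "0 < m"
  show "lower_growth m \<le> real m powr boyd_alpha X N"
  proof (cases "m = 1")
    case True
    then show ?thesis using lower_le_upper_growth[of 1] upper_growth_le[of 1] by simp
  next
    case False
    then have "ln (lower_growth m) \<le> ln (real m powr (- L))"
      using L(2)[of m] m by (simp add: ln_powr)
    then show ?thesis using lower_growth_ge_1[OF m] m by (subst (asm) ln_le_cancel_iff) auto
  qed
qed

lemma upper_growth_eventually:
  assumes "boyd_beta X N < b"
  shows "eventually (\<lambda>m. upper_growth m \<le> real m powr b) sequentially"
  using order_tendstoD(2)[OF upper_growth_limit(1) assms] eventually_gt_at_top[of 1]
proof eventually_elim
  case (elim m)
  then have "ln (upper_growth m) \<le> ln (real m powr b)"
    by (simp add: ln_powr field_simps)
  then show ?case using elim upper_growth_ge_1[of m] by (subst (asm) ln_le_cancel_iff) auto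
qed

lemma lower_growth_eventually:
  assumes "b < boyd_alpha X N"
  shows "eventually (\<lambda>m. real m powr b \<le> lower_growth m) sequentially"
  using order_tendstoD(1)[OF lower_growth_limit(1) assms] eventually_gt_at_top[of 1]
proof eventually_elim
  case (elim m)
  then have "ln (real m powr b) \<le> ln (lower_growth m)"
    by (simp add: ln_powr field_simps)
  then show ?case using elim lower_growth_ge_1[of m] by (subst (asm) ln_le_cancel_iff) auto
qed

lemma boyd_bounds: "0 \<le> boyd_alpha X N" "boyd_alpha X N \<le> boyd_beta X N" "boyd_beta X N \<le> 1"
proof -
  have "2 powr (0::real) \<le> 2 powr boyd_alpha X N"
    using lower_growth_ge_1[of 2] lower_growth_limit(2)[of 2] by simp
  then show "0 \<le> boyd_alpha X N" by (subst (asm) powr_le_cancel_iff) auto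
  have "2 powr boyd_beta X N \<le> 2 powr (1::real)"
    using upper_growth_le[of 2] upper_growth_limit(2)[of 2] by simp
  then show "boyd_beta X N \<le> 1" by (subst (asm) powr_le_cancel_iff) auto
  show "boyd_alpha X N \<le> boyd_beta X N"
  proof (rule LIMSEQ_le[OF lower_growth_limit(1) upper_growth_limit(1)], intro exI allI impI)
    fix m :: nat assume "2 \<le> m"
    then show "ln (lower_growth m) / ln (real m) \<le> ln (upper_growth m) / ln (real m)"
      using lower_le_upper_growth[of m] lower_growth_ge_1[of m] by (intro divide_right_mono) auto
  qed
qed

end

section \<open>Approximate eigenvectors of the doubling operator\<close>

text \<open>The damping factor for a sum whose length \<open>K\<close> is already fixed:
  \<open>q ^ K \<ge> 1 / 2\<close> keeps at least half of its first weights, and the last condition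
  makes the induced shift of the eigenvalue small.\<close>

lemma exists_near_one:
  fixes d :: real
  assumes "0 < d"
  obtains q :: real where "1 / 2 \<le> q" "q < 1" "1 / 2 \<le> q ^ K" "2 * (1 / q - 1) \<le> d"
proof -
  have t1: "((\<lambda>q::real. q ^ K) \<longlongrightarrow> 1 ^ K) (at_left 1)"
    and t2: "((\<lambda>q::real. 2 * (1 / q - 1)) \<longlongrightarrow> 2 * (1 / 1 - 1)) (at_left 1)"
    and t3: "((\<lambda>q::real. q) \<longlongrightarrow> 1) (at_left 1)"
    by (intro tendsto_intros; simp)+
  have "eventually (\<lambda>q::real. 1 / 2 < q ^ K) (at_left 1)"
    "eventually (\<lambda>q::real. 2 * (1 / q - 1) < d) (at_left 1)"
    "eventually (\<lambda>q::real. 1 / 2 < q) (at_left 1)"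
    using order_tendstoD(1)[OF t1, of "1 / 2"] order_tendstoD(2)[OF t2, of d]
      order_tendstoD(1)[OF t3, of "1 / 2"] assms by simp_all
  moreover have "eventually (\<lambda>q::real. q < 1) (at_left 1)"
    by (simp add: eventually_at_filter)
  ultimately have "eventually (\<lambda>q::real. 1 / 2 < q ^ K \<and> 2 * (1 / q - 1) < d \<and> 1 / 2 < q \<and> q < 1) (at_left 1)"
    by eventually_elim auto
  then obtain q :: real where "1 / 2 < q ^ K \<and> 2 * (1 / q - 1) < d \<and> 1 / 2 < q \<and> q < 1"
    using eventually_happens[of _ "at_left (1::real)"] by auto
  then show ?thesis by (intro that[of q]) auto
qed

lemma powr_two_power: "real (2 ^ n) powr b = (2 powr b) ^ n"
  by (induction n) (simp_all add: powr_mult)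

text \<open>A partial sum of the Neumann series of \<open>(1 - c \<sigma>_2)^(-1) h\<close>.\<close>

definition geometric_sum :: "real \<Rightarrow> nat \<Rightarrow> (nat \<Rightarrow> real) \<Rightarrow> nat \<Rightarrow> real" where
  "geometric_sum c n h = (\<lambda>k. \<Sum>j\<le>n. c ^ j * dil_up (2 ^ j) h k)"

lemma dil_up_geometric_sum: "dil_up m (geometric_sum c n h) = geometric_sum c n (dil_up m h)"
proof -
  have "dil_up (2 ^ j) h (k div m) = dil_up (2 ^ j) (dil_up m h) k" for j k
    using dil_up_dil_up[of m "2 ^ j" h] dil_up_dil_up[of "2 ^ j" m h]
    by (metis dil_up_def mult.commute)
  moreover have "dil_up m (geometric_sum c n h) k = geometric_sum c n h (k div m)" for k
    by (simp add: dil_up_def[of m])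
  ultimately show ?thesis unfolding geometric_sum_def by presburger
qed

context nontrivial_sym_space
begin

lemma decreasing_geometric_sum:
  "decreasing h \<Longrightarrow> 0 \<le> c \<Longrightarrow> decreasing (geometric_sum c n h)"
  unfolding geometric_sum_def
  by (intro decreasing_sum decreasing_scale decreasing_dil_up) auto

text \<open>In the square of the orbit sum the total exponent \<open>K\<close> arises in
  \<open>K + 1\<close> ways, each with weight \<open>c ^ K\<close>. All other terms are nonnegative
  and may be dropped.\<close>

lemma N_dil_up_le_geometric_sum_twice:
  assumes "decreasing h" "0 \<le> c"
  shows "real (K + 1) * c ^ K * N (dil_up (2 ^ K) h) \<le> N (geometric_sum c K (geometric_sum c K h))"
proof -
  have "real (K + 1) * c ^ K * dil_up (2 ^ K) h k \<le> geometric_sum c K (geometric_sum c K h) k" for k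
  proof -
    have "real (K + 1) * c ^ K * dil_up (2 ^ K) h k = (\<Sum>i\<le>K. c ^ K * dil_up (2 ^ K) h k)"
      by simp
    also have "\<dots> \<le> (\<Sum>i\<le>K. c ^ i * dil_up (2 ^ i) (geometric_sum c K h) k)"
    proof (rule sum_mono)
      fix i assume "i \<in> {..K}"
      then have i: "i + (K - i) = K" by simp
      have "c ^ (K - i) * dil_up (2 ^ (K - i)) (dil_up (2 ^ i) h) k \<le> geometric_sum c K (dil_up (2 ^ i) h) k"
        unfolding geometric_sum_def
        by (rule member_le_sum[of "K - i" "{..K}" "\<lambda>j. c ^ j * dil_up (2 ^ j) (dil_up (2 ^ i) h) k"])
          (use assms decreasing_nonneg[OF decreasing_dil_up[OF decreasing_dil_up[OF assms(1)]]] in auto)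
      then have "c ^ i * (c ^ (K - i) * dil_up (2 ^ (K - i)) (dil_up (2 ^ i) h) k)
          \<le> c ^ i * geometric_sum c K (dil_up (2 ^ i) h) k"
        using assms by (intro mult_left_mono) auto
      moreover have "dil_up (2 ^ (K - i)) (dil_up (2 ^ i) h) = dil_up (2 ^ K) h"
        using i by (simp add: dil_up_dil_up power_add[symmetric] add.commute)
      moreover have "c ^ i * c ^ (K - i) = c ^ K" using i by (simp add: power_add[symmetric])
      ultimately show "c ^ K * dil_up (2 ^ K) h k \<le> c ^ i * dil_up (2 ^ i) (geometric_sum c K h) k"
        by (simp add: dil_up_geometric_sum mult.assoc[symmetric])
    qed
    finally show ?thesis by (simp add: geometric_sum_def)
  qed
  then have "N (\<lambda>k. (real (K + 1) * c ^ K) * dil_up (2 ^ K) h k) \<le> N (geometric_sum c K (geometric_sum c K h))"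
    using assms decreasing_nonneg[OF decreasing_dil_up[OF assms(1)], of "2 ^ K"]
    by (intro N_mono decreasing_geometric_sum) auto
  then show ?thesis
    using N_scale[OF dil_up_in(1)[OF _ decreasing_in[OF assms(1)]], of "2 ^ K" "real (K + 1) * c ^ K"] assms(2)
    by (simp add: abs_mult)
qed

text \<open>Applying \<open>c \<sigma>_2\<close> shifts the sum by one place: the first term
  \<open>h\<close> is lost and one new last term appears. The remaining summand of the bound is the
  gap between \<open>1 / c\<close> and the intended eigenvalue \<open>l\<close>.\<close>

lemma geometric_sum_eigen_error:
  assumes "decreasing h" "0 < c"
  shows "N (\<lambda>k. dil_up 2 (geometric_sum c n h) k - l * geometric_sum c n h k)
    \<le> \<bar>1 / c - l\<bar> * N (geometric_sum c n h) + N h / c + c ^ n * N (dil_up (2 ^ Suc n) h)"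
proof -
  let ?G = "geometric_sum c n h"
  have G: "?G \<in> X" and h: "h \<in> X" and e: "dil_up (2 ^ Suc n) h \<in> X"
    using assms decreasing_geometric_sum[of h c n] decreasing_in dil_up_in(1)[of "2 ^ Suc n"] by auto
  have eq: "dil_up 2 ?G k - l * ?G k
     = ((1 / c - l) * ?G k + (- (1 / c)) * h k) + c ^ n * dil_up (2 ^ Suc n) h k" for k
  proof -
    have "c * dil_up 2 ?G k = (\<Sum>j\<le>n. c ^ Suc j * dil_up (2 ^ Suc j) h k)"
      unfolding dil_up_geometric_sum
      by (simp add: geometric_sum_def dil_up_dil_up sum_distrib_left mult.assoc mult.commute[of _ "2::nat"])
    also have "\<dots> = (\<Sum>j\<le>Suc n. c ^ j * dil_up (2 ^ j) h k) - h k"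
      by (subst sum.atMost_Suc_shift) (simp add: dil_up_1)
    also have "\<dots> = ?G k + c ^ Suc n * dil_up (2 ^ Suc n) h k - h k"
      by (simp add: geometric_sum_def)
    finally have "dil_up 2 ?G k = (?G k + c ^ Suc n * dil_up (2 ^ Suc n) h k - h k) / c"
      using assms(2) by (simp add: eq_divide_eq mult.commute)
    then show ?thesis
      using assms(2) by (simp add: diff_divide_distrib add_divide_distrib left_diff_distrib)
  qed
  have "N (\<lambda>k. dil_up 2 ?G k - l * ?G k) \<le>
     (N (\<lambda>k. (1 / c - l) * ?G k) + N (\<lambda>k. (- (1 / c)) * h k)) + N (\<lambda>k. c ^ n * dil_up (2 ^ Suc n) h k)"
    unfolding eq
    by (intro order_trans[OF N_add] add_right_mono N_add add_in scale_in G h e)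
  then show ?thesis
    using assms(2) unfolding N_scale[OF G] N_scale[OF h] N_scale[OF e] by simp
qed

definition approx_eigenvalue :: "real \<Rightarrow> bool" where
  "approx_eigenvalue l \<longleftrightarrow>
    (\<forall>d>0. \<exists>f. decreasing f \<and> 0 < N f \<and> N (\<lambda>k. dil_up 2 f k - l * f k) \<le> d * N f)"

text \<open>Write $A = 2^{-\beta}\sigma_2$. If $\sum_{j\le K} A^j$ had norm at most $C$ on decreasing sequences, its square
  would give $(K+1)\,\|A^K\| \le C^2$, against $\|A^K\| \ge 1$ for all $K$.\<close>

lemma large_geometric_sum_upper:
  fixes C :: real
  assumes "0 < C"
  obtains K h where "decreasing h" "C * N h < N (geometric_sum (1 / 2 powr boyd_beta X N) K h)"
proof -
  define l where "l = 2 powr boyd_beta X N"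
  have l: "0 < l" by (simp add: l_def)
  obtain K :: nat where K: "C * C < real K" using reals_Archimedean2 by blast
  have "\<exists>h. decreasing h \<and> C * N h < N (geometric_sum (1 / l) K h)"
  proof (rule ccontr)
    assume "\<not> ?thesis"
    then have le: "N (geometric_sum (1 / l) K h) \<le> C * N h" if "decreasing h" for h
      using that by force
    have "N (dil_up (2 ^ K) h) \<le> C * C * l ^ K / real (K + 1) * N h" if h: "decreasing h" for h
    proof -
      have "real (K + 1) * (1 / l) ^ K * N (dil_up (2 ^ K) h) \<le> C * N (geometric_sum (1 / l) K h)"
        using N_dil_up_le_geometric_sum_twice[OF h, of "1 / l" K] l
          le[OF decreasing_geometric_sum[OF h, of "1 / l" K]] by simp
      also have "\<dots> \<le> C * (C * N h)" using le[OF h] assms by (intro mult_left_mono) auto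
      finally show ?thesis using l by (simp add: field_simps)
    qed
    then have "upper_growth (2 ^ K) \<le> C * C * l ^ K / real (K + 1)"
      using assms l by (intro upper_growth_least) auto
    moreover have "l ^ K \<le> upper_growth (2 ^ K)"
      using upper_growth_limit(2)[of "2 ^ K"] unfolding l_def powr_two_power by simp
    ultimately have "l ^ K \<le> C * C * l ^ K / real (K + 1)" by linarith
    then have "l ^ K * real (K + 1) \<le> l ^ K * (C * C)"
      by (simp add: pos_le_divide_eq mult_ac)
    then have "real (K + 1) \<le> C * C" using l by simp
    then show False using K by simp
  qed
  then show ?thesis using that by (auto simp: l_def)
qed

text \<open>The weight \<open>c = q / l\<close>, slightly below \<open>1 / l\<close>, makes the new
  last term at a suitable late \<open>n\<close> at most \<open>N h / c\<close>. The longer damped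
  sum still dominates \<open>q ^ K\<close> times the undamped sum of length \<open>K\<close>, which
  is large against \<open>N h\<close>. Hence both boundary terms are small relative to
  \<open>?G\<close>.\<close>

lemma approx_eigenvalue_beta: "approx_eigenvalue (2 powr boyd_beta X N)"
  unfolding approx_eigenvalue_def
proof (intro allI impI)
  fix d :: real assume d: "0 < d"
  define l where "l = 2 powr boyd_beta X N"
  have "2 powr boyd_beta X N \<le> 2 powr (1::real)" "2 powr (0::real) \<le> 2 powr boyd_beta X N"
    using boyd_bounds by (subst powr_le_cancel_iff; simp)+
  then have l: "1 \<le> l" "l \<le> 2" by (simp_all add: l_def)
  \<comment> \<open>Since \<open>1 / c = l / q \<le> 4\<close>, the two boundary terms cost at most
    \<open>8 * N h\<close>. Half of \<open>C\<close> survives the damping, and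
    \<open>8 = d / 2 * (C / 2)\<close>.\<close>
  define C where "C = 32 / d"
  have C: "0 < C" using d by (simp add: C_def)
  obtain K h where h: "decreasing h" and big: "C * N h < N (geometric_sum (1 / l) K h)"
    using large_geometric_sum_upper[OF C] unfolding l_def .
  obtain q :: real where q: "1 / 2 \<le> q" "q < 1" "1 / 2 \<le> q ^ K" "2 * (1 / q - 1) \<le> d / 2"
    using exists_near_one[of "d / 2" K] d by auto
  define c where "c = q / l"
  have c: "0 < c" using q l by (simp add: c_def)
  \<comment> \<open>As \<open>q < 1\<close>, this exponent is strictly above the index, so it bounds
    the growth factor eventually; the index itself need not.\<close>
  define b where "b = log 2 (l / q)"
  have b: "2 powr b = l / q" using q l by (simp add: b_def)
  have "boyd_beta X N < b"
    using q l by (simp add: b_def less_log_iff l_def[symmetric] field_simps)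
  then have "eventually (\<lambda>m. upper_growth m \<le> real m powr b) sequentially"
    by (rule upper_growth_eventually)
  moreover have "filterlim (\<lambda>n. 2 ^ Suc n :: nat) sequentially sequentially"
    by (rule filterlim_subseq) (auto simp: strict_mono_Suc_iff)
  ultimately have "eventually (\<lambda>n. upper_growth (2 ^ Suc n) \<le> real (2 ^ Suc n) powr b) sequentially"
    by (rule eventually_compose_filterlim)
  then obtain n where n: "K \<le> n" "upper_growth (2 ^ Suc n) \<le> real (2 ^ Suc n) powr b"
    using eventually_ge_at_top[of K] by (metis (mono_tags, lifting) eventually_conj eventually_happens trivial_limit_sequentially)
  have "real (2 ^ Suc n) powr b = (2 powr b) ^ Suc n"
    by (rule powr_two_power)
  then have n2: "upper_growth (2 ^ Suc n) \<le> 1 / c ^ Suc n"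
    using n(2) b by (simp add: c_def power_divide)
  let ?G = "geometric_sum c n h"
  have G: "decreasing ?G" using decreasing_geometric_sum[OF h] c by simp
  have "q ^ K * geometric_sum (1 / l) K h k \<le> ?G k" for k
  proof -
    have "q ^ K * geometric_sum (1 / l) K h k = (\<Sum>j\<le>K. q ^ K * (1 / l) ^ j * dil_up (2 ^ j) h k)"
      by (simp add: geometric_sum_def sum_distrib_left mult.assoc)
    also have "\<dots> \<le> (\<Sum>j\<le>K. q ^ j * (1 / l) ^ j * dil_up (2 ^ j) h k)"
      using q l decreasing_nonneg[OF decreasing_dil_up[OF h]]
      by (intro sum_mono mult_right_mono power_decreasing) auto
    also have "\<dots> = (\<Sum>j\<le>K. c ^ j * dil_up (2 ^ j) h k)"
      by (simp add: c_def power_divide)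
    also have "\<dots> \<le> ?G k"
      unfolding geometric_sum_def using n(1) c decreasing_nonneg[OF decreasing_dil_up[OF h]]
      by (intro sum_mono2) auto
    finally show ?thesis .
  qed
  then have "N (\<lambda>k. q ^ K * geometric_sum (1 / l) K h k) \<le> N ?G"
    using G q l decreasing_nonneg[OF decreasing_geometric_sum[OF h]]
    by (intro N_mono) auto
  then have "q ^ K * N (geometric_sum (1 / l) K h) \<le> N ?G"
    using N_scale[OF decreasing_in[OF decreasing_geometric_sum[OF h, of "1 / l" K]], of "q ^ K"] q l by simp
  moreover have "1 / 2 * N (geometric_sum (1 / l) K h) \<le> q ^ K * N (geometric_sum (1 / l) K h)"
    using q l N_nonneg[OF decreasing_in[OF decreasing_geometric_sum[OF h, of "1 / l" K]]]
    by (intro mult_right_mono) auto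
  ultimately have big': "C / 2 * N h < N ?G" using big by simp
  have Nh: "0 \<le> N h" using N_nonneg decreasing_in h by blast
  have "c ^ n * N (dil_up (2 ^ Suc n) h) \<le> c ^ n * (1 / c ^ Suc n * N h)"
    using upper_growth_bound[OF _ decreasing_in[OF h], of "2 ^ Suc n"] c
      mult_right_mono[OF n2 Nh] by (intro mult_left_mono) auto
  also have "\<dots> = N h / c" using c by simp
  finally have "N (\<lambda>k. dil_up 2 ?G k - l * ?G k) \<le> \<bar>1 / c - l\<bar> * N ?G + N h / c + N h / c"
    using geometric_sum_eigen_error[OF h c, of n l] by linarith
  also have "\<bar>1 / c - l\<bar> = l * (1 / q - 1)"
    using q l by (simp add: c_def field_simps abs_of_nonneg)
  also have "l * (1 / q - 1) * N ?G \<le> d / 2 * N ?G"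
  proof (rule mult_right_mono)
    have "l * (1 / q - 1) \<le> 2 * (1 / q - 1)" using q l by (intro mult_right_mono) (auto simp: field_simps)
    then show "l * (1 / q - 1) \<le> d / 2" using q by linarith
  qed (use N_nonneg decreasing_in G in blast)
  also have "1 / c \<le> 4"
    using q l by (simp add: c_def field_simps)
  then have "N h / c \<le> 4 * N h" using mult_right_mono[OF _ Nh] by fastforce
  moreover have "8 * N h \<le> d / 2 * N ?G"
    using big' d by (simp add: C_def field_simps)
  ultimately have "N (\<lambda>k. dil_up 2 ?G k - l * ?G k) \<le> d * N ?G" by linarith
  moreover have "0 < N ?G" using big' Nh C by (smt (verit) divide_pos_pos mult_nonneg_nonneg)
  ultimately show "\<exists>f. decreasing f \<and> 0 < N f \<and> N (\<lambda>k. dil_up 2 f k - 2 powr boyd_beta X N * f k) \<le> d * N f"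
    using G unfolding l_def by blast
qed

text \<open>Write $A = 2^{-\alpha}\sigma_2$. If $\|\sum_{j\le K} A^j f\| \le C\,\|A^K f\|$ on the range of $A^L$, then, as above,
  $\|A^{2K} f\| \ge 2\,\|A^K f\|$ there; iterating contradicts that the lower growth factor of $A^n$ is at most $1$.
  The index $K$ must not depend on $L$, since $L$ is chosen later in terms of $K$.\<close>

lemma large_geometric_sum_lower:
  fixes C :: real
  assumes "0 < C"
  obtains K where "\<And>L. \<exists>h. decreasing h \<and>
    C / (2 powr boyd_alpha X N) ^ K * N (dil_up (2 ^ (L + K)) h)
      < N (geometric_sum (1 / 2 powr boyd_alpha X N) K (dil_up (2 ^ L) h))"
proof -
  define l where "l = 2 powr boyd_alpha X N"
  have l: "0 < l" by (simp add: l_def)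
  \<comment> \<open>The factor 2 here becomes the gain of 2 in \<open>step\<close>. Iterated n
    times, it would exceed the fixed constant \<open>l ^ (L + K)\<close>.\<close>
  obtain K :: nat where K: "2 * (C * C) < real K" using reals_Archimedean2 by blast
  have "\<exists>h. decreasing h \<and>
    C / l ^ K * N (dil_up (2 ^ (L + K)) h) < N (geometric_sum (1 / l) K (dil_up (2 ^ L) h))" for L
  proof (rule ccontr)
    assume "\<not> ?thesis"
    then have le: "N (geometric_sum (1 / l) K (dil_up (2 ^ L) h)) \<le> C / l ^ K * N (dil_up (2 ^ (L + K)) h)"
      if "decreasing h" for h
      using that by force
    have step: "2 * l ^ K * N (dil_up (2 ^ (L + K)) h) \<le> N (dil_up (2 ^ (L + K + K)) h)"
      if h: "decreasing h" for h
    proof -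
      have "real (K + 1) * (1 / l) ^ K * N (dil_up (2 ^ K) (dil_up (2 ^ L) h))
        \<le> N (geometric_sum (1 / l) K (geometric_sum (1 / l) K (dil_up (2 ^ L) h)))"
        using h l by (intro N_dil_up_le_geometric_sum_twice decreasing_dil_up) auto
      also have "\<dots> \<le> C / l ^ K * N (dil_up (2 ^ (L + K)) (geometric_sum (1 / l) K h))"
        using le[OF decreasing_geometric_sum[OF h, of "1 / l" K]] l by (simp add: dil_up_geometric_sum)
      also have "dil_up (2 ^ (L + K)) (geometric_sum (1 / l) K h)
          = geometric_sum (1 / l) K (dil_up (2 ^ L) (dil_up (2 ^ K) h))"
        by (simp add: dil_up_geometric_sum dil_up_dil_up power_add)
      also have "C / l ^ K * N \<dots> \<le> C / l ^ K * (C / l ^ K * N (dil_up (2 ^ (L + K)) (dil_up (2 ^ K) h)))"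
        using le[OF decreasing_dil_up[OF h, of "2 ^ K"]] assms l by (intro mult_left_mono) auto
      finally have *: "real (K + 1) * (1 / l) ^ K * N (dil_up (2 ^ (L + K)) h)
          \<le> C / l ^ K * (C / l ^ K * N (dil_up (2 ^ (L + K + K)) h))"
        by (simp add: dil_up_dil_up power_add mult.commute)
      have "2 * (C * C) * (1 / l) ^ K * N (dil_up (2 ^ (L + K)) h)
         \<le> real (K + 1) * (1 / l) ^ K * N (dil_up (2 ^ (L + K)) h)"
        using K l N_nonneg[OF dil_up_in(1)[OF _ decreasing_in[OF h]], of "2 ^ (L + K)"]
        by (intro mult_right_mono) auto
      also note *
      finally show ?thesis using l assms by (simp add: field_simps)
    qed
    have iter: "(2 * l ^ K) ^ n * N h \<le> N (dil_up (2 ^ (L + K + n * K)) h)" if h: "decreasing h" for h n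
      using h
    proof (induction n arbitrary: h)
      case 0
      then show ?case using dil_up_inD(2)[OF _ dil_up_in(1)[OF _ decreasing_in[OF 0]]] by simp
    next
      case (Suc n)
      have h': "decreasing (dil_up (2 ^ (n * K)) h)" using Suc.prems by (rule decreasing_dil_up) simp
      have "(2 * l ^ K) ^ Suc n * N h = 2 * l ^ K * ((2 * l ^ K) ^ n * N h)" by simp
      also have "\<dots> \<le> 2 * l ^ K * N (dil_up (2 ^ (L + K + n * K)) h)"
        using Suc.IH[OF Suc.prems] l by (intro mult_left_mono) auto
      also have "\<dots> \<le> N (dil_up (2 ^ (L + K + K)) (dil_up (2 ^ (n * K)) h))"
        using step[OF h'] by (simp add: dil_up_dil_up power_add)
      finally show ?case by (simp add: dil_up_dil_up power_add mult_ac)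
    qed
    have "2 ^ n \<le> l ^ (L + K)" for n
    proof -
      have "(2 * l ^ K) ^ n \<le> lower_growth (2 ^ (L + K + n * K))"
        using iter l by (intro lower_growth_greatest) auto
      also have "\<dots> \<le> real (2 ^ (L + K + n * K)) powr boyd_alpha X N"
        by (intro lower_growth_limit(2)) simp
      also have "\<dots> = l ^ (L + K + n * K)"
        unfolding l_def by (rule powr_two_power)
      also have "\<dots> = l ^ (L + K) * (l ^ K) ^ n" by (simp add: power_add power_mult mult.commute)
      finally show ?thesis using l by (simp add: power_mult_distrib)
    qed
    moreover obtain n where "l ^ (L + K) < 2 ^ n" using real_arch_pow[of 2 "l ^ (L + K)"] by auto
    ultimately show False by (meson not_less)
  qed
  then show ?thesis using that unfolding l_def by blast
qed

text \<open>Here \<open>c = 1 / (q * l)\<close> lies above \<open>1 / l\<close>, and the last term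
  of the sum takes the role that \<open>h\<close> has for the upper index. From \<open>L\<close> on,
  the lower growth bound gives \<open>N h \<le> c ^ n * ?D\<close>, and the new last term is at most
  twice \<open>c ^ n * ?D\<close>. The sum is made large against this quantity by its summands with
  indices from \<open>L\<close> to \<open>L + K\<close> alone.\<close>

lemma approx_eigenvalue_alpha: "approx_eigenvalue (2 powr boyd_alpha X N)"
  unfolding approx_eigenvalue_def
proof (intro allI impI)
  fix d :: real assume d: "0 < d"
  define l where "l = 2 powr boyd_alpha X N"
  have "2 powr boyd_alpha X N \<le> 2 powr (1::real)" "2 powr (0::real) \<le> 2 powr boyd_alpha X N"
    using boyd_bounds by (subst powr_le_cancel_iff; simp)+
  then have l: "1 \<le> l" "l \<le> 2" by (simp_all add: l_def)
  \<comment> \<open>The boundary terms cost at most \<open>4 * c ^ n * N (dil_up (2 ^ n) h)\<close>,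
    while half of \<open>C\<close> survives the damping; 32 leaves room.\<close>
  define C where "C = 32 / d"
  have C: "0 < C" using d by (simp add: C_def)
  obtain K where big: "\<And>L. \<exists>h. decreasing h \<and>
    C / l ^ K * N (dil_up (2 ^ (L + K)) h) < N (geometric_sum (1 / l) K (dil_up (2 ^ L) h))"
    using large_geometric_sum_lower[OF C] unfolding l_def by blast
  obtain q :: real where q: "1 / 2 \<le> q" "q < 1" "1 / 2 \<le> q ^ K" "2 * (1 / q - 1) \<le> d / 2"
    using exists_near_one[of "d / 2" K] d by auto
  define c where "c = 1 / (q * l)"
  have c: "0 < c" using q l by (simp add: c_def)
  define b where "b = log 2 (q * l)"
  have b: "2 powr b = q * l" using q l by (simp add: b_def)
  have "b < boyd_alpha X N"
    using q l by (simp add: b_def log_less_iff l_def[symmetric])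
  then have "eventually (\<lambda>m. real m powr b \<le> lower_growth m) sequentially"
    by (rule lower_growth_eventually)
  moreover have "filterlim (\<lambda>n. 2 ^ n :: nat) sequentially sequentially"
    by (rule filterlim_subseq) (auto simp: strict_mono_Suc_iff)
  ultimately have "eventually (\<lambda>n. real (2 ^ n) powr b \<le> lower_growth (2 ^ n)) sequentially"
    by (rule eventually_compose_filterlim)
  then obtain L where L: "\<And>n. L \<le> n \<Longrightarrow> real (2 ^ n) powr b \<le> lower_growth (2 ^ n)"
    unfolding eventually_sequentially by blast
  obtain h where h: "decreasing h"
    and bigL: "C / l ^ K * N (dil_up (2 ^ (L + K)) h) < N (geometric_sum (1 / l) K (dil_up (2 ^ L) h))"
    using big by blast
  define n where "n = L + K"
  have "real (2 ^ n) powr b = (2 powr b) ^ n"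
    by (rule powr_two_power)
  then have n2: "1 / c ^ n \<le> lower_growth (2 ^ n)"
    using L[of n] b by (simp add: c_def n_def power_divide)
  let ?G = "geometric_sum c n h" and ?D = "N (dil_up (2 ^ n) h)"
  have G: "decreasing ?G" using decreasing_geometric_sum[OF h] c by simp
  have hX: "h \<in> X" and hL: "decreasing (dil_up (2 ^ L) h)"
    using h decreasing_in decreasing_dil_up by auto
  have "c ^ L * geometric_sum (1 / l) K (dil_up (2 ^ L) h) k \<le> ?G k" for k
  proof -
    have "1 / l \<le> c" using q l by (simp add: c_def field_simps)
    have "c ^ L * geometric_sum (1 / l) K (dil_up (2 ^ L) h) k
        = (\<Sum>j\<le>K. c ^ L * (1 / l) ^ j * dil_up (2 ^ (j + L)) h k)"
      by (simp add: geometric_sum_def sum_distrib_left mult.assoc dil_up_dil_up power_add)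
    also have "\<dots> \<le> (\<Sum>j\<le>K. c ^ L * c ^ j * dil_up (2 ^ (j + L)) h k)"
      using c l \<open>1 / l \<le> c\<close> decreasing_nonneg[OF decreasing_dil_up[OF h]]
      by (intro sum_mono mult_right_mono mult_left_mono power_mono) auto
    also have "\<dots> = (\<Sum>j\<in>(\<lambda>j. j + L) ` {..K}. c ^ j * dil_up (2 ^ j) h k)"
      by (simp add: sum.reindex power_add mult.commute)
    also have "\<dots> \<le> ?G k"
      unfolding geometric_sum_def using c decreasing_nonneg[OF decreasing_dil_up[OF h]]
      by (intro sum_mono2) (auto simp: n_def)
    finally show ?thesis .
  qed
  then have "N (\<lambda>k. c ^ L * geometric_sum (1 / l) K (dil_up (2 ^ L) h) k) \<le> N ?G"
    using G c l decreasing_nonneg[OF decreasing_geometric_sum[OF hL]]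
    by (intro N_mono) auto
  then have "c ^ L * N (geometric_sum (1 / l) K (dil_up (2 ^ L) h)) \<le> N ?G"
    using N_scale[OF decreasing_in[OF decreasing_geometric_sum[OF hL, of "1 / l" K]], of "c ^ L"] c l by simp
  moreover have "c ^ L * (C / l ^ K * ?D) < c ^ L * N (geometric_sum (1 / l) K (dil_up (2 ^ L) h))"
    using bigL c by (intro mult_strict_left_mono) (auto simp: n_def)
  \<comment> \<open>\<open>c * q * l = 1\<close> and \<open>n = L + K\<close> turn
    \<open>c ^ L / l ^ K\<close> into \<open>q ^ K * c ^ n\<close>.\<close>
  moreover have "c ^ L * (C / l ^ K * ?D) = q ^ K * (C * (c ^ n * ?D))"
    using q l by (simp add: c_def n_def power_add power_mult_distrib field_simps)
  moreover have D: "0 \<le> c ^ n * ?D" using c N_nonneg[OF dil_up_in(1)[OF _ hX]] by simp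
  then have "1 / 2 * (C * (c ^ n * ?D)) \<le> q ^ K * (C * (c ^ n * ?D))"
    using q C by (intro mult_right_mono) auto
  ultimately have big': "C / 2 * (c ^ n * ?D) < N ?G" by simp
  have "1 / c ^ n * N h \<le> lower_growth (2 ^ n) * N h"
    using n2 N_nonneg[OF hX] by (intro mult_right_mono) auto
  also have "\<dots> \<le> ?D" by (intro lower_growth_bound hX) simp
  finally have Nh: "N h \<le> c ^ n * ?D" using c by (simp add: field_simps)
  have "N (dil_up (2 ^ Suc n) h) \<le> 2 * ?D"
    using dil_up_in(2)[OF _ dil_up_in(1)[OF _ hX], of 2 "2 ^ n"] by (simp add: dil_up_dil_up)
  then have "c ^ n * N (dil_up (2 ^ Suc n) h) \<le> 2 * (c ^ n * ?D)"
    using mult_left_mono[of "N (dil_up (2 ^ Suc n) h)" "2 * ?D" "c ^ n"] c by simp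
  then have "N (\<lambda>k. dil_up 2 ?G k - l * ?G k) \<le> \<bar>1 / c - l\<bar> * N ?G + N h / c + 2 * (c ^ n * ?D)"
    using geometric_sum_eigen_error[OF h c, of n l] by linarith
  also have "\<bar>1 / c - l\<bar> = l * (1 - q)"
    using q l by (simp add: c_def field_simps abs_if)
  also have "l * (1 - q) * N ?G \<le> d / 2 * N ?G"
  proof (rule mult_right_mono)
    have "1 - q \<le> (1 - q) / q" using q by (simp add: pos_le_divide_eq mult_left_le)
    also have "\<dots> = 1 / q - 1" using q by (simp add: diff_divide_distrib)
    finally have "1 - q \<le> 1 / q - 1" .
    then have "l * (1 - q) \<le> 2 * (1 / q - 1)" using q l by (intro mult_mono) auto
    then show "l * (1 - q) \<le> d / 2" using q by linarith
  qed (use N_nonneg decreasing_in G in blast)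
  also have "N h / c \<le> 2 * (c ^ n * ?D)"
  proof -
    have "1 / c \<le> 2" using q l mult_mono[of q 1 l 2] by (simp add: c_def)
    then have "1 / c * N h \<le> 2 * (c ^ n * ?D)" using Nh N_nonneg[OF hX] c by (intro mult_mono) auto
    then show ?thesis by simp
  qed
  moreover have "4 * (c ^ n * ?D) \<le> d / 2 * N ?G"
    using big' d D unfolding C_def by (simp add: field_simps)
  ultimately have "N (\<lambda>k. dil_up 2 ?G k - l * ?G k) \<le> d * N ?G" by linarith
  moreover have "0 < N ?G" using big' D C by (smt (verit) divide_pos_pos mult_nonneg_nonneg)
  ultimately show "\<exists>f. decreasing f \<and> 0 < N f \<and> N (\<lambda>k. dil_up 2 f k - 2 powr boyd_alpha X N * f k) \<le> d * N f"
    using G unfolding l_def by blast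
qed

end

section \<open>Approximate eigenvectors of all dilations simultaneously\<close>

lemma sum_blocks:
  fixes \<phi> :: "nat \<Rightarrow> real"
  assumes "1 \<le> n"
  shows "(\<Sum>j\<in>{1..<n}. \<Sum>i\<in>{m * j..<m * (j + 1)}. \<phi> i) = (\<Sum>i\<in>{m..<m * n}. \<phi> i)"
  using assms
proof (induction n rule: dec_induct)
  case (step n)
  have "(\<Sum>i\<in>{m..<m * Suc n}. \<phi> i) = (\<Sum>i\<in>{m..<m * n}. \<phi> i) + (\<Sum>i\<in>{m * n..<m * Suc n}. \<phi> i)"
    using step by (intro sum.atLeastLessThan_concat[symmetric]) auto
  then show ?case using step by (simp add: sum.atLeastLessThan_Suc)
qed simp

text \<open>Bounds the increments of the weight by a telescoping sequence, so their total does not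
  depend on the range. With \<open>x = j\<close> and \<open>y = j + 1\<close>, the subtracted term
  is \<open>(x / y) powr \<gamma> / y\<close>, at least \<open>x / y^2\<close>, and
  \<open>1 / x - x / y^2 = (1 / x - 1 / y) * (1 + x / y)\<close>.\<close>

lemma weight_diff_bound:
  assumes "0 \<le> \<gamma>" "\<gamma> \<le> 1" "1 \<le> (j::nat)"
  shows "(real j powr (- 1 - \<gamma>) - real (j + 1) powr (- 1 - \<gamma>)) * real j powr \<gamma> \<le> 2 * (1 / real j - 1 / real (j + 1))"
proof -
  define x y where "x = real j" and "y = real (j + 1)"
  have xy: "0 < x" "x < y" using assms by (auto simp: x_def y_def)
  have "x / y = (x / y) powr 1" using xy by simp
  also have "\<dots> \<le> (x / y) powr \<gamma>" using xy assms by (intro powr_mono') auto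
  finally have "x / y \<le> (x / y) powr \<gamma>" .
  then have "1 / y * (x / y) \<le> 1 / y * (x / y) powr \<gamma>" using xy by (intro mult_left_mono) auto
  also have "\<dots> = y powr (- 1 - \<gamma>) * x powr \<gamma>"
    using xy by (simp add: powr_divide powr_diff powr_minus field_simps)
  finally have 1: "1 / y * (x / y) \<le> y powr (- 1 - \<gamma>) * x powr \<gamma>" .
  have 2: "x powr (- 1 - \<gamma>) * x powr \<gamma> = 1 / x"
    using xy by (simp add: powr_add[symmetric] powr_minus_divide)
  have "1 / x - 1 / y * (x / y) = (1 / x - 1 / y) * (1 + x / y)"
    using xy by (simp add: field_simps)
  also have "\<dots> \<le> (1 / x - 1 / y) * 2"
    using xy by (intro mult_left_mono) (auto simp: field_simps)
  finally have 3: "1 / x - 1 / y * (x / y) \<le> (1 / x - 1 / y) * 2" .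
  have "(x powr (- 1 - \<gamma>) - y powr (- 1 - \<gamma>)) * x powr \<gamma> = 1 / x - y powr (- 1 - \<gamma>) * x powr \<gamma>"
    using 2 by (simp add: left_diff_distrib)
  also have "\<dots> \<le> 1 / x - 1 / y * (x / y)" using 1 by (rule diff_left_mono)
  also note 3
  finally show ?thesis by (simp add: x_def y_def mult.commute)
qed

text \<open>A comparison as for Riemann sums. Because
  \<open>m * m powr \<gamma> * h (m * j) = h j\<close>, the term \<open>h j * F (m * j)\<close> is
  close to \<open>m powr \<gamma>\<close> times the sum of \<open>h i * F i\<close> over the block
  of \<open>m\<close> indices starting at \<open>m * j\<close>. These blocks tile
  \<open>{m..<m * n}\<close>, which differs from \<open>{1..<n}\<close> only at the two ends. It is
  used pointwise, with \<open>F i = dil_up i f k\<close>.\<close>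

lemma weighted_dilation_sum_error:
  fixes F :: "nat \<Rightarrow> real"
  assumes \<gamma>: "0 \<le> \<gamma>" "\<gamma> \<le> 1" and m: "1 \<le> m" and n: "1 \<le> n"
    and F0: "\<And>i. 0 \<le> F i" and F_mono: "\<And>i j. 1 \<le> i \<Longrightarrow> i \<le> j \<Longrightarrow> F i \<le> F j"
  defines "h \<equiv> \<lambda>i. real i powr (- 1 - \<gamma>)"
  shows "\<bar>(\<Sum>j\<in>{1..<n}. h j * F (m * j)) - real m powr \<gamma> * (\<Sum>j\<in>{1..<n}. h j * F j)\<bar>
    \<le> ((\<Sum>j\<in>{1..<n}. (2 * (h j - h (j + 1))) * F (m * (j + 1))) + h n * F (m * n))
      + real m powr \<gamma> * ((\<Sum>i\<in>{1..<m}. h i * F i) + (\<Sum>i\<in>{n..<m * n}. h i * F i))"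
proof -
  define L where "L = (\<Sum>j\<in>{1..<n}. h j * F (m * j))"
  define G where "G = (\<Sum>j\<in>{1..<n}. h j * F j)"
  define E1 where "E1 = (\<Sum>j\<in>{1..<n}. (2 * (h j - h (j + 1))) * F (m * (j + 1)))"
  define E2 where "E2 = h n * F (m * n)"
  define E3 where "E3 = (\<Sum>i\<in>{1..<m}. h i * F i)"
  define E4 where "E4 = (\<Sum>i\<in>{n..<m * n}. h i * F i)"
  have h0: "0 \<le> h i" for i by (simp add: h_def)
  have h_mono: "h j \<le> h i" if "1 \<le> i" "i \<le> j" for i j
    using that \<gamma> unfolding h_def by (intro powr_mono2') auto
  have hm: "real m powr \<gamma> * h (m * j) = h j / real m" for j
    using m by (simp add: h_def powr_mult powr_diff powr_minus field_simps)
  have hm': "real m powr \<gamma> * (real m * (h (m * j) * c)) = h j * c" for j c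
  proof -
    have "real m powr \<gamma> * (real m * (h (m * j) * c)) = (real m powr \<gamma> * h (m * j)) * real m * c"
      by (simp only: mult_ac)
    then show ?thesis unfolding hm using m by simp
  qed
  define B where "B j = real m powr \<gamma> * (\<Sum>i\<in>{m * j..<m * (j + 1)}. h i * F i)" for j
  have card: "card {m * j..<m * (j + 1)} = m" for j by simp
  have B_bounds: "h (j + 1) * F (m * j) \<le> B j" "B j \<le> h j * F (m * (j + 1))" if j: "1 \<le> j" for j
  proof -
    have mj: "1 \<le> m * j" using m j by simp
    have "(\<Sum>i\<in>{m * j..<m * (j + 1)}. h (m * (j + 1)) * F (m * j)) \<le> (\<Sum>i\<in>{m * j..<m * (j + 1)}. h i * F i)"
    proof (rule sum_mono)
      fix i assume i: "i \<in> {m * j..<m * (j + 1)}"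
      then have "1 \<le> i" using mj unfolding atLeastLessThan_iff by linarith
      then show "h (m * (j + 1)) * F (m * j) \<le> h i * F i"
        using i mj by (intro mult_mono h_mono F_mono h0 F0) auto
    qed
    then have "real m powr \<gamma> * (real m * (h (m * (j + 1)) * F (m * j))) \<le> B j"
      unfolding B_def by (intro mult_left_mono) (auto simp: card)
    moreover have "real m powr \<gamma> * (real m * (h (m * (j + 1)) * F (m * j))) = h (j + 1) * F (m * j)"
      by (rule hm')
    ultimately show "h (j + 1) * F (m * j) \<le> B j" by (simp only:)
    have "(\<Sum>i\<in>{m * j..<m * (j + 1)}. h i * F i) \<le> (\<Sum>i\<in>{m * j..<m * (j + 1)}. h (m * j) * F (m * (j + 1)))"
    proof (rule sum_mono)
      fix i assume i: "i \<in> {m * j..<m * (j + 1)}"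
      then have "1 \<le> i" using mj unfolding atLeastLessThan_iff by linarith
      then show "h i * F i \<le> h (m * j) * F (m * (j + 1))"
        using i mj by (intro mult_mono h_mono F_mono h0 F0) auto
    qed
    then have "B j \<le> real m powr \<gamma> * (real m * (h (m * j) * F (m * (j + 1))))"
      unfolding B_def by (intro mult_left_mono) (auto simp: card)
    moreover have "real m powr \<gamma> * (real m * (h (m * j) * F (m * (j + 1)))) = h j * F (m * (j + 1))"
      by (rule hm')
    ultimately show "B j \<le> h j * F (m * (j + 1))" by (simp only:)
  qed
  have "\<bar>L - (\<Sum>j\<in>{1..<n}. B j)\<bar>
      \<le> (\<Sum>j\<in>{1..<n}. \<bar>h j * F (m * j) - B j\<bar>)"
    unfolding L_def by (simp add: sum_subtractf[symmetric] sum_abs)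
  \<comment> \<open>The block error is split into an increment of the weight and a difference of
    consecutive values of \<open>h j * F (m * j)\<close>; the latter telescopes to
    \<open>E2\<close>.\<close>
  also have "\<dots> \<le> (\<Sum>j\<in>{1..<n}. (2 * (h j - h (j + 1))) * F (m * (j + 1)) + (h (j + 1) * F (m * (j + 1)) - h j * F (m * j)))"
  proof (rule sum_mono)
    fix j assume "j \<in> {1..<n}"
    then have j: "1 \<le> j" by simp
    have hj: "h (j + 1) \<le> h j" and Fj: "F (m * j) \<le> F (m * (j + 1))"
      using j m by (auto intro!: h_mono F_mono)
    have "h (j + 1) * F (m * j) \<le> h j * F (m * j)" "h j * F (m * j) \<le> h j * F (m * (j + 1))"
      "(h j - h (j + 1)) * F (m * j) \<le> (h j - h (j + 1)) * F (m * (j + 1))"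
      using hj Fj F0 h0 by (auto intro!: mult_right_mono mult_left_mono)
    then show "\<bar>h j * F (m * j) - B j\<bar>
      \<le> (2 * (h j - h (j + 1))) * F (m * (j + 1)) + (h (j + 1) * F (m * (j + 1)) - h j * F (m * j))"
      using B_bounds[OF j] by (simp add: abs_le_iff algebra_simps)
  qed
  also have "\<dots> = E1 + (\<Sum>j\<in>{1..<n}. h (Suc j) * F (m * Suc j) - h j * F (m * j))"
    by (simp add: E1_def sum.distrib)
  also have "(\<Sum>j\<in>{1..<n}. h (Suc j) * F (m * Suc j) - h j * F (m * j)) = h n * F (m * n) - h 1 * F (m * 1)"
    using n by (intro sum_Suc_diff') auto
  also have "E1 + \<dots> \<le> E1 + E2"
    using h0[of 1] F0[of m] by (simp add: E2_def)
  finally have 1: "\<bar>L - (\<Sum>j\<in>{1..<n}. B j)\<bar> \<le> E1 + E2" .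
  have eqB: "(\<Sum>j\<in>{1..<n}. B j) = real m powr \<gamma> * (\<Sum>i\<in>{m..<m * n}. h i * F i)"
    unfolding B_def sum_distrib_left[symmetric] using sum_blocks[OF n] by simp
  have "(\<Sum>i\<in>{1..<m}. h i * F i) + (\<Sum>i\<in>{m..<m * n}. h i * F i)
     = (\<Sum>i\<in>{1..<n}. h i * F i) + (\<Sum>i\<in>{n..<m * n}. h i * F i)"
    using m n by (simp add: sum.atLeastLessThan_concat)
  moreover have "G = (\<Sum>i\<in>{1..<n}. h i * F i)"
    unfolding G_def by (rule refl)
  ultimately have "(\<Sum>i\<in>{m..<m * n}. h i * F i) = G + (E4 - E3)"
    unfolding E3_def E4_def by linarith
  then have "(\<Sum>j\<in>{1..<n}. B j) = real m powr \<gamma> * (G + (E4 - E3))"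
    unfolding eqB by (rule arg_cong)
  then have eqBg: "(\<Sum>j\<in>{1..<n}. B j) - real m powr \<gamma> * G = real m powr \<gamma> * (E4 - E3)"
    by (simp only: distrib_left add_diff_cancel_left')
  have "\<bar>E4 - E3\<bar> \<le> E3 + E4"
  proof -
    have "0 \<le> E3" "0 \<le> E4" unfolding E3_def E4_def using h0 F0 by (auto intro!: sum_nonneg)
    then show ?thesis by linarith
  qed
  then have "real m powr \<gamma> * \<bar>E4 - E3\<bar> \<le> real m powr \<gamma> * (E3 + E4)" by (intro mult_left_mono) auto
  then have "\<bar>(\<Sum>j\<in>{1..<n}. B j) - real m powr \<gamma> * G\<bar> \<le> real m powr \<gamma> * (E3 + E4)"
    unfolding eqBg abs_mult by simp
  then have "\<bar>L - real m powr \<gamma> * G\<bar> \<le> (E1 + E2) + real m powr \<gamma> * (E3 + E4)" using 1 by linarith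
  then show ?thesis by (simp only: L_def G_def E1_def E2_def E3_def E4_def)
qed

context nontrivial_sym_space
begin

definition dilation_average :: "real \<Rightarrow> nat \<Rightarrow> (nat \<Rightarrow> real) \<Rightarrow> nat \<Rightarrow> real" where
  "dilation_average \<gamma> n f = (\<lambda>k. \<Sum>j\<in>{1..<n}. real j powr (- 1 - \<gamma>) * dil_up j f k)"

lemma decreasing_dilation_average: "decreasing f \<Longrightarrow> decreasing (dilation_average \<gamma> n f)"
  unfolding dilation_average_def by (intro decreasing_sum decreasing_scale decreasing_dil_up) auto

lemma dil_up_mono: "decreasing f \<Longrightarrow> i \<le> j \<Longrightarrow> 0 < i \<Longrightarrow> dil_up i f k \<le> dil_up j f k"
  using div_le_mono2[of i j k] by (auto simp: decreasing_def dil_up_def)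

text \<open>The point is that the bound is free of \<open>n\<close>. \<open>E1\<close> costs
  \<open>8 * A * m\<close> by telescoping, \<open>E2\<close> costs \<open>A * m\<close>, and
  \<open>E3\<close>, \<open>E4\<close> cost \<open>A * m\<close> each, multiplied by
  \<open>m powr \<gamma> \<le> m\<close>; this gives 11. The growth hypothesis reaches only to
  \<open>m * n\<close>, since an approximate eigenvector controls only finitely many
  dilations.\<close>

lemma dilation_average_error:
  assumes f: "decreasing f" and \<gamma>: "0 \<le> \<gamma>" "\<gamma> \<le> 1" and m: "1 \<le> m" and n: "1 \<le> n"
    and A: "0 \<le> A" "\<And>j. 1 \<le> j \<Longrightarrow> j \<le> m * n \<Longrightarrow> N (dil_up j f) \<le> A * real j powr \<gamma>"
  defines "g \<equiv> dilation_average \<gamma> n f"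
  shows "N (\<lambda>k. dil_up m g k - real m powr \<gamma> * g k) \<le> 11 * A * (real m)\<^sup>2"
proof -
  define h where "h i = real i powr (- 1 - \<gamma>)" for i :: nat
  define E1 where "E1 = (\<lambda>k. \<Sum>j\<in>{1..<n}. (2 * (h j - h (j + 1))) * dil_up (m * (j + 1)) f k)"
  define E2 where "E2 = (\<lambda>k. h n * dil_up (m * n) f k)"
  define E3 where "E3 = (\<lambda>k. \<Sum>i\<in>{1..<m}. h i * dil_up i f k)"
  define E4 where "E4 = (\<lambda>k. \<Sum>i\<in>{n..<m * n}. h i * dil_up i f k)"
  have h0: "0 \<le> h i" for i by (simp add: h_def)
  have h_mono: "h j \<le> h i" if "1 \<le> i" "i \<le> j" for i j
    using that \<gamma> unfolding h_def by (intro powr_mono2') auto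
  have mg: "real m powr \<gamma> \<le> real m" using powr_mono[of \<gamma> 1 "real m"] \<gamma> m by simp
  have f0: "0 \<le> dil_up i f k" for i k using decreasing_nonneg[OF f] by (simp add: dil_up_def)
  have point: "\<bar>dil_up m g k - real m powr \<gamma> * g k\<bar> \<le> (E1 k + E2 k) + real m powr \<gamma> * (E3 k + E4 k)" for k
  proof -
    have "dil_up j f (k div m) = dil_up (m * j) f k" for j
      by (simp add: dil_up_def div_mult2_eq)
    moreover have "dil_up m g k = g (k div m)" by (simp add: dil_up_def)
    ultimately have "dil_up m g k = (\<Sum>j\<in>{1..<n}. h j * dil_up (m * j) f k)"
      unfolding g_def dilation_average_def h_def by presburger
    then show ?thesis
      using weighted_dilation_sum_error[OF \<gamma> m n, of "\<lambda>i. dil_up i f k"] f0 dil_up_mono[OF f]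
      unfolding g_def dilation_average_def E1_def E2_def E3_def E4_def h_def by simp
  qed
  have fX: "dil_up i f \<in> X" if "1 \<le> i" for i
    using dil_up_in(1)[OF _ decreasing_in[OF f]] that by simp
  have term_in: "(\<lambda>k. c * dil_up i f k) \<in> X" if "1 \<le> i" for c i
    using fX[OF that] by (rule scale_in)
  have N_term: "N (\<lambda>k. c * dil_up i f k) \<le> c * (A * real i powr \<gamma>)" if "0 \<le> c" "1 \<le> i" "i \<le> m * n" for c i
    using that N_scale[OF fX[OF that(2)], of c] A(2)[of i] by (simp add: mult_left_mono)
  have h_term: "h i * (A * real i powr \<gamma>) = A / real i" if "1 \<le> i" for i
    using that by (simp add: h_def powr_diff powr_minus field_simps)
  have A_div: "A / real i \<le> A" if "1 \<le> i" for i
    using that A(1) mult_left_mono[of 1 "real i" A] by (simp add: pos_divide_le_eq)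
  have E1: "E1 \<in> X" "N E1 \<le> 8 * A * real m"
  proof -
    show "E1 \<in> X" unfolding E1_def using m by (intro sum_in term_in) auto
    have "N E1 \<le> (\<Sum>j\<in>{1..<n}. N (\<lambda>k. (2 * (h j - h (j + 1))) * dil_up (m * (j + 1)) f k))"
      unfolding E1_def using m by (intro sum_in term_in) auto
    also have "\<dots> \<le> (\<Sum>j\<in>{1..<n}. 8 * A * real m * (1 / real j - 1 / real (j + 1)))"
    proof (rule sum_mono)
      fix j assume j: "j \<in> {1..<n}"
      have hj: "0 \<le> h j - h (j + 1)" using h_mono[of j "j + 1"] j by simp
      have "m * (j + 1) \<le> m * n" using j by (intro mult_le_mono2) auto
      then have "N (\<lambda>k. (2 * (h j - h (j + 1))) * dil_up (m * (j + 1)) f k)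
        \<le> 2 * (h j - h (j + 1)) * (A * real (m * (j + 1)) powr \<gamma>)"
        using hj m by (intro N_term) auto
      also have "\<dots> \<le> 2 * (h j - h (j + 1)) * (A * (real (m * 2) * real j powr \<gamma>))"
      proof -
        have "real (m * (j + 1)) powr \<gamma> \<le> real (m * 2 * j) powr \<gamma>"
          using j \<gamma> by (intro powr_mono2) (auto simp del: of_nat_mult of_nat_add simp: of_nat_le_iff)
        also have "\<dots> = real (m * 2) powr \<gamma> * real j powr \<gamma>"
          by (simp add: powr_mult)
        also have "\<dots> \<le> real (m * 2) * real j powr \<gamma>"
          using m \<gamma> powr_mono[of \<gamma> 1 "real (m * 2)"] by (intro mult_right_mono) auto
        finally show ?thesis using hj A(1) by (intro mult_left_mono) auto
      qed
      also have "\<dots> = 4 * A * real m * ((h j - h (j + 1)) * real j powr \<gamma>)"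
        by simp
      also have "\<dots> \<le> 4 * A * real m * (2 * (1 / real j - 1 / real (j + 1)))"
        unfolding h_def using weight_diff_bound[OF \<gamma>, of j] j A(1) by (intro mult_left_mono) auto
      finally show "N (\<lambda>k. (2 * (h j - h (j + 1))) * dil_up (m * (j + 1)) f k)
          \<le> 8 * A * real m * (1 / real j - 1 / real (j + 1))"
        by (simp add: mult.assoc[symmetric] mult.commute[of _ 2] right_diff_distrib)
    qed
    also have "\<dots> = 8 * A * real m * (\<Sum>j\<in>{1..<n}. (- 1 / real (Suc j)) - (- 1 / real j))"
      by (simp add: sum_distrib_left)
    also have "(\<Sum>j\<in>{1..<n}. (- 1 / real (Suc j)) - (- 1 / real j)) = (- 1 / real n) - (- 1 / real 1)"
      using n by (intro sum_Suc_diff') auto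
    also have "8 * A * real m * ((- 1 / real n) - (- 1 / real 1)) \<le> 8 * A * real m * 1"
      using A(1) by (intro mult_left_mono) auto
    finally show "N E1 \<le> 8 * A * real m" by simp
  qed
  have E2: "E2 \<in> X" "N E2 \<le> A * real m"
  proof -
    show "E2 \<in> X" unfolding E2_def using m n by (intro term_in) auto
    have "N E2 \<le> h n * (A * real (m * n) powr \<gamma>)"
      unfolding E2_def using m n by (intro N_term h0) auto
    also have "\<dots> = (h n * (A * real n powr \<gamma>)) * real m powr \<gamma>" by (simp add: powr_mult)
    also have "\<dots> = A / real n * real m powr \<gamma>" using h_term n by simp
    also have "\<dots> \<le> A * real m" using n A(1) mg A_div[of n] by (intro mult_mono) auto
    finally show "N E2 \<le> A * real m" .
  qed
  have E3: "E3 \<in> X" "N E3 \<le> A * real m"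
  proof -
    show "E3 \<in> X" unfolding E3_def by (intro sum_in term_in) auto
    have "N E3 \<le> (\<Sum>i\<in>{1..<m}. N (\<lambda>k. h i * dil_up i f k))"
      unfolding E3_def by (intro sum_in term_in) auto
    also have "\<dots> \<le> (\<Sum>i\<in>{1..<m}. A)"
    proof (rule sum_mono)
      fix i assume i: "i \<in> {1..<m}"
      then have "i \<le> m * n" using n by (auto intro: order_trans[of i m])
      then have "N (\<lambda>k. h i * dil_up i f k) \<le> A / real i"
        using N_term[OF h0[of i], of i] h_term[of i] i by simp
      also have "\<dots> \<le> A" using i by (intro A_div) auto
      finally show "N (\<lambda>k. h i * dil_up i f k) \<le> A" .
    qed
    also have "\<dots> \<le> A * real m" using A(1) by (simp add: mult.commute mult_left_mono)
    finally show "N E3 \<le> A * real m" .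
  qed
  have E4: "E4 \<in> X" "N E4 \<le> A * real m"
  proof -
    show "E4 \<in> X" unfolding E4_def using n by (intro sum_in term_in) auto
    have "N E4 \<le> (\<Sum>i\<in>{n..<m * n}. N (\<lambda>k. h i * dil_up i f k))"
      unfolding E4_def using n by (intro sum_in term_in) auto
    also have "\<dots> \<le> (\<Sum>i\<in>{n..<m * n}. A / real n)"
    proof (rule sum_mono)
      fix i assume i: "i \<in> {n..<m * n}"
      then have "N (\<lambda>k. h i * dil_up i f k) \<le> A / real i"
        using N_term[OF h0[of i], of i] h_term[of i] n by simp
      also have "\<dots> \<le> A / real n" using i n A(1) by (intro divide_left_mono) auto
      finally show "N (\<lambda>k. h i * dil_up i f k) \<le> A / real n" .
    qed
    also have "\<dots> = real (m * n - n) * (A / real n)" by simp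
    also have "\<dots> \<le> real (m * n) * (A / real n)" using A(1) by (intro mult_right_mono of_nat_mono diff_le_self) auto
    also have "\<dots> = A * real m" using n by simp
    finally show "N E4 \<le> A * real m" .
  qed
  let ?E = "\<lambda>k. (E1 k + E2 k) + real m powr \<gamma> * (E3 k + E4 k)"
  have EX: "?E \<in> X" by (intro add_in scale_in E1 E2 E3 E4)
  have "N (\<lambda>k. dil_up m g k - real m powr \<gamma> * g k) \<le> N ?E"
    using point by (intro solid(2)[OF EX]) (meson abs_ge_self order_trans)
  also have "\<dots> \<le> (N E1 + N E2) + N (\<lambda>k. real m powr \<gamma> * (E3 k + E4 k))"
    by (intro order_trans[OF N_add] add_right_mono N_add add_in scale_in E1 E2 E3 E4)
  also have "N (\<lambda>k. real m powr \<gamma> * (E3 k + E4 k)) \<le> real m powr \<gamma> * (N E3 + N E4)"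
    using N_scale[OF add_in[OF E3(1) E4(1)], of "real m powr \<gamma>"] N_add[OF E3(1) E4(1)]
    by (simp add: mult_left_mono)
  also have "\<dots> \<le> real m * (A * real m + A * real m)"
    using E3 E4 mg N_nonneg[OF E3(1)] N_nonneg[OF E4(1)] by (intro mult_mono add_mono) auto
  finally have "N (\<lambda>k. dil_up m g k - real m powr \<gamma> * g k) \<le> 9 * (A * real m) + 2 * (A * (real m)\<^sup>2)"
    using E1 E2 by (simp add: power2_eq_square algebra_simps)
  moreover have "A * real m \<le> A * (real m)\<^sup>2"
    using m A(1) by (intro mult_left_mono) (auto simp: power2_eq_square)
  ultimately show ?thesis by simp
qed

text \<open>\<open>\<sigma>_(2^(i+1)) f - l^(i+1) f = \<sigma>_(2^i) (\<sigma>_2 f - l f) + l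
  (\<sigma>_(2^i) f - l^i f)\<close>, so each step at most doubles the old error and adds
  \<open>2 ^ i * d\<close>.\<close>

lemma dil_up_power_error:
  assumes f: "f \<in> X" and l: "0 \<le> l" "l \<le> 2" and d: "0 \<le> d" "N (\<lambda>k. dil_up 2 f k - l * f k) \<le> d"
  shows "N (\<lambda>k. dil_up (2 ^ i) f k - l ^ i * f k) \<le> real i * 2 ^ i * d"
proof (induction i)
  case 0
  then show ?case by (simp add: dil_up_1 N_zero)
next
  case (Suc i)
  let ?u = "\<lambda>k. dil_up 2 f k - l * f k" and ?v = "\<lambda>k. dil_up (2 ^ i) f k - l ^ i * f k"
  have X: "?u \<in> X" "?v \<in> X" by (intro diff_in dil_up_in scale_in f; simp)+
  have "dil_up (2 ^ Suc i) f k - l ^ Suc i * f k = dil_up (2 ^ i) ?u k + l * ?v k" for k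
    by (simp add: dil_up_def div_mult2_eq[symmetric] algebra_simps)
  then have "N (\<lambda>k. dil_up (2 ^ Suc i) f k - l ^ Suc i * f k) = N (\<lambda>k. dil_up (2 ^ i) ?u k + l * ?v k)"
    by presburger
  also have "\<dots> \<le> N (dil_up (2 ^ i) ?u) + N (\<lambda>k. l * ?v k)"
    by (intro N_add dil_up_in scale_in X) simp
  also have "N (dil_up (2 ^ i) ?u) \<le> 2 ^ i * N ?u" using dil_up_in(2)[OF _ X(1), of "2 ^ i"] by simp
  also have "2 ^ i * N ?u \<le> 2 ^ i * d" using d by simp
  also have "N (\<lambda>k. l * ?v k) = l * N ?v" using N_scale[OF X(2), of l] l by simp
  also have "l * N ?v \<le> 2 * (real i * 2 ^ i * d)" using Suc l N_nonneg[OF X(2)] by (intro mult_mono) auto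
  also have "2 ^ i * d + 2 * (real i * 2 ^ i * d) \<le> real (Suc i) * 2 ^ Suc i * d"
    using d by (simp add: algebra_simps)
  finally show ?case by simp
qed

text \<open>In the dyadic block \<open>{2 ^ i..<2 ^ (i + 1)}\<close> take the smallest weight and
  the smallest dilation for all \<open>2 ^ i\<close> terms. Since
  \<open>2 powr \<gamma> \<le> 2\<close>, this leaves a quarter of \<open>\<sigma>_(2^i) f\<close>
  divided by \<open>(2 powr \<gamma>) ^ i\<close>, which is \<open>f\<close> up to
  \<open>N f / 2\<close>. Hence each of the \<open>k\<close> blocks yields \<open>1 / 8\<close>, and
  the norm grows with the logarithm of the range.\<close>

lemma dilation_average_lower:
  assumes f: "decreasing f" and \<gamma>: "0 \<le> \<gamma>" "\<gamma> \<le> 1"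
    and err: "\<And>i. i < k \<Longrightarrow> N (\<lambda>t. dil_up (2 ^ i) f t - (2 powr \<gamma>) ^ i * f t) \<le> N f / 2"
  shows "real k / 8 * N f \<le> N (dilation_average \<gamma> (2 ^ k) f)"
proof -
  define l where "l = 2 powr \<gamma>"
  have "2 powr \<gamma> \<le> 2 powr (1::real)" "2 powr (0::real) \<le> 2 powr \<gamma>"
    using \<gamma> by (subst powr_le_cancel_iff; simp)+
  then have l: "1 \<le> l" "l \<le> 2" by (simp_all add: l_def)
  let ?S = "\<lambda>t. \<Sum>i<k. (1 / l ^ i) * dil_up (2 ^ i) f t"
  have fX: "f \<in> X" by (rule decreasing_in[OF f])
  have S: "decreasing ?S" using l by (intro decreasing_sum decreasing_scale decreasing_dil_up f) auto
  have "1 / 4 * ?S t \<le> dilation_average \<gamma> (2 ^ k) f t" for t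
  proof (induction k)
    case 0
    then show ?case by (simp add: dilation_average_def)
  next
    case (Suc k)
    have "real (2 ^ Suc k) powr (- 1 - \<gamma>) = 1 / (2 ^ Suc k * l ^ Suc k)"
      by (simp only: powr_diff powr_minus l_def powr_two_power) (simp add: powr_diff powr_minus field_simps powr_two_power[symmetric])
    then have eq: "(\<Sum>j\<in>{(2::nat) ^ k..<2 ^ Suc k}. real (2 ^ Suc k) powr (- 1 - \<gamma>) * dil_up (2 ^ k) f t)
        = dil_up (2 ^ k) f t / (2 * l * l ^ k)"
      using l by simp
    have "1 / 4 * ((1 / l ^ k) * dil_up (2 ^ k) f t) = dil_up (2 ^ k) f t / (4 * l ^ k)" by simp
    also have "\<dots> \<le> dil_up (2 ^ k) f t / (2 * l * l ^ k)"
      using l decreasing_nonneg[OF decreasing_dil_up[OF f, of "2 ^ k"], of t]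
      by (intro divide_left_mono mult_right_mono) auto
    also have "\<dots> = (\<Sum>j\<in>{(2::nat) ^ k..<2 ^ Suc k}. real (2 ^ Suc k) powr (- 1 - \<gamma>) * dil_up (2 ^ k) f t)"
      by (rule eq[symmetric])
    also have "\<dots> \<le> (\<Sum>j\<in>{(2::nat) ^ k..<2 ^ Suc k}. real j powr (- 1 - \<gamma>) * dil_up j f t)"
    proof (intro sum_mono mult_mono)
      fix j :: nat assume j: "j \<in> {(2::nat) ^ k..<2 ^ Suc k}"
      then have "0 < j" "real j \<le> real (2 ^ Suc k)"
        by (auto intro: less_le_trans[of 0 "2 ^ k"] simp del: of_nat_power of_nat_mult)
      then show "real (2 ^ Suc k) powr (- 1 - \<gamma>) \<le> real j powr (- 1 - \<gamma>)"
        using \<gamma> by (intro powr_mono2') auto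
      show "dil_up (2 ^ k) f t \<le> dil_up j f t" using j by (intro dil_up_mono f) auto
    qed (use decreasing_nonneg[OF decreasing_dil_up[OF f]] in auto)
    finally have "1 / 4 * ((1 / l ^ k) * dil_up (2 ^ k) f t) \<le> (\<Sum>j\<in>{(2::nat) ^ k..<2 ^ Suc k}. real j powr (- 1 - \<gamma>) * dil_up j f t)" .
    moreover have "dilation_average \<gamma> (2 ^ Suc k) f t = dilation_average \<gamma> (2 ^ k) f t
        + (\<Sum>j\<in>{(2::nat) ^ k..<2 ^ Suc k}. real j powr (- 1 - \<gamma>) * dil_up j f t)"
      unfolding dilation_average_def by (intro sum.atLeastLessThan_concat[symmetric]) auto
    ultimately show ?case using Suc by (simp add: algebra_simps)
  qed
  then have "N (\<lambda>t. 1 / 4 * ?S t) \<le> N (dilation_average \<gamma> (2 ^ k) f)"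
    using decreasing_nonneg[OF S] by (intro N_mono decreasing_dilation_average f) auto
  then have low: "1 / 4 * N ?S \<le> N (dilation_average \<gamma> (2 ^ k) f)"
    using N_scale[OF decreasing_in[OF S], of "1 / 4"] by simp
  let ?e = "\<lambda>i t. (1 / l ^ i) * (dil_up (2 ^ i) f t - l ^ i * f t)"
  have eX: "?e i \<in> X" for i by (intro scale_in diff_in dil_up_in fX) simp
  have "N (?e i) \<le> N f / 2" if "i < k" for i
  proof -
    have "N (?e i) = (1 / l ^ i) * N (\<lambda>t. dil_up (2 ^ i) f t - l ^ i * f t)"
      using l by (subst N_scale) (auto intro!: scale_in diff_in dil_up_in fX)
    also have "\<dots> \<le> 1 * (N f / 2)"
      using err[OF that] l N_nonneg[OF fX]
      by (intro mult_mono N_nonneg diff_in scale_in dil_up_in fX) (auto simp: l_def)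
    finally show ?thesis by simp
  qed
  then have "(\<Sum>i<k. N (?e i)) \<le> (\<Sum>i<k. N f / 2)" by (intro sum_mono) auto
  then have e: "N (\<lambda>t. \<Sum>i<k. ?e i t) \<le> real k * N f / 2"
    using sum_in(2)[of "{..<k}" ?e] eX by simp
  have "real k * f t = ?S t - (\<Sum>i<k. ?e i t)" for t
    using l by (simp add: sum_subtractf[symmetric] right_diff_distrib)
  then have "N (\<lambda>t. real k * f t) = N (\<lambda>t. ?S t - (\<Sum>i<k. ?e i t))" by presburger
  also have "\<dots> \<le> N ?S + N (\<lambda>t. \<Sum>i<k. ?e i t)"
    by (intro N_diff decreasing_in S sum_in eX) auto
  finally have "real k * N f / 2 \<le> N ?S" using e N_scale[OF fX, of "real k"] by simp
  then show ?thesis using low by simp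
qed

text \<open>One \<open>g\<close> has to serve all \<open>m \<le> M\<close>, because a single
  combination uses several multiplicities of the same sequence.\<close>

definition joint_eigenvector :: "real \<Rightarrow> bool" where
  "joint_eigenvector \<gamma> \<longleftrightarrow> (\<forall>M. \<forall>e>0. \<exists>g. g \<in> X \<and> (\<forall>k. 0 \<le> g k) \<and> 0 < N g \<and>
    (\<forall>m\<in>{1..M}. N (\<lambda>k. dil_up m g k - real m powr \<gamma> * g k) \<le> e * N g))"

lemma joint_eigenvector_if_approx_eigenvalue:
  assumes ev: "approx_eigenvalue (2 powr \<gamma>)" and \<gamma>: "0 \<le> \<gamma>" "\<gamma> \<le> 1"
  shows "joint_eigenvector \<gamma>"
  unfolding joint_eigenvector_def
proof (intro allI impI)
  fix M :: nat and e :: real assume e: "0 < e"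
  define l where "l = 2 powr \<gamma>"
  have "2 powr \<gamma> \<le> 2 powr (1::real)" "2 powr (0::real) \<le> 2 powr \<gamma>"
    using \<gamma> by (subst powr_le_cancel_iff; simp)+
  then have l: "1 \<le> l" "l \<le> 2" by (simp_all add: l_def)
  \<comment> \<open>\<open>352 = 11 * 4 * 8\<close>: the constant of
    \<open>dilation_average_error\<close>, the growth constant \<open>4 * N f\<close>, and the
    \<open>1 / 8\<close> of \<open>dilation_average_lower\<close>.\<close>
  obtain k :: nat where k: "352 * (real M)\<^sup>2 / e < real k" using reals_Archimedean2 by blast
  have k0: "0 < k" 
  proof -
    have "0 \<le> 352 * (real M)\<^sup>2 / e" using e by simp
    then show ?thesis using k by linarith
  qed
  \<comment> \<open>All dilations of \<open>f\<close> that occur have \<open>m * j < 2 ^ T\<close>.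
    The precision \<open>d\<close> keeps the accumulated error \<open>i * 2 ^ i * d\<close> at most
    \<open>1 / 2\<close> for every \<open>i \<le> T\<close>.\<close>
  define T where "T = k + M"
  define d where "d = 1 / (2 * (real T * 2 ^ T))"
  have T: "0 < T" using k0 by (simp add: T_def)
  have d: "0 < d" using T by (simp add: d_def)
  obtain f where f: "decreasing f" "0 < N f" and df: "N (\<lambda>k. dil_up 2 f k - l * f k) \<le> d * N f"
    using ev d unfolding approx_eigenvalue_def l_def by blast
  have fX: "f \<in> X" by (rule decreasing_in[OF f(1)])
  have err: "N (\<lambda>t. dil_up (2 ^ i) f t - l ^ i * f t) \<le> N f / 2" if "i \<le> T" for i
  proof -
    have "N (\<lambda>t. dil_up (2 ^ i) f t - l ^ i * f t) \<le> real i * 2 ^ i * (d * N f)"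
      using l d f df by (intro dil_up_power_error fX) auto
    also have "\<dots> \<le> real T * 2 ^ T * (d * N f)"
      using that d f by (intro mult_right_mono mult_mono) auto
    also have "\<dots> = N f / 2" using T by (simp add: d_def)
    finally show ?thesis .
  qed
  have up: "N (dil_up (2 ^ i) f) \<le> 2 * l ^ i * N f" if "i \<le> T" for i
  proof -
    have "N (dil_up (2 ^ i) f) - N (\<lambda>t. l ^ i * f t) \<le> N f / 2"
      using N_reverse[OF dil_up_in(1)[OF _ fX] scale_in[OF fX], of "2 ^ i" "l ^ i"] err[OF that] by auto
    then have "N (dil_up (2 ^ i) f) \<le> l ^ i * N f + N f / 2"
      using N_scale[OF fX, of "l ^ i"] l by simp
    moreover have "1 * N f \<le> l ^ i * N f"
      using l f(2) by (intro mult_right_mono) auto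
    ultimately show ?thesis using f(2) by linarith
  qed
  have A: "N (dil_up j f) \<le> 4 * N f * real j powr \<gamma>" if j: "1 \<le> j" "j < 2 ^ T" for j
  proof -
    obtain i where i: "2 ^ i \<le> j" "j < 2 ^ (i + 1)" using ex_power_ivl1[of 2 j] j by auto
    have "(2::nat) ^ i < 2 ^ T" using i j by linarith
    then have iT: "i + 1 \<le> T" by simp
    have "N (dil_up j f) \<le> N (dil_up (2 ^ (i + 1)) f)" using i j by (intro dil_up_mono_N fX) auto
    also have "\<dots> \<le> 2 * l ^ (i + 1) * N f" by (rule up[OF iT])
    also have "\<dots> \<le> 4 * N f * l ^ i" using l f by simp
    also have "l ^ i = real (2 ^ i) powr \<gamma>" by (simp only: l_def powr_two_power)
    also have "\<dots> \<le> real j powr \<gamma>" using i \<gamma> by (intro powr_mono2) (auto simp del: of_nat_power simp: of_nat_le_iff)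
    finally show ?thesis using f by (simp add: mult_left_mono)
  qed
  define g where "g = dilation_average \<gamma> (2 ^ k) f"
  have g: "decreasing g" unfolding g_def by (rule decreasing_dilation_average[OF f(1)])
  have low: "real k / 8 * N f \<le> N g"
    unfolding g_def by (rule dilation_average_lower[OF f(1) \<gamma>]) (use err in \<open>auto simp: l_def T_def\<close>)
  have "N (\<lambda>t. dil_up m g t - real m powr \<gamma> * g t) \<le> e * N g" if m: "m \<in> {1..M}" for m
  proof -
    have "m < 2 ^ M" using m by (intro le_less_trans[OF _ less_exp]) simp
    then have "m * 2 ^ k < 2 ^ T" by (simp add: T_def power_add mult.commute)
    then have "N (\<lambda>t. dil_up m g t - real m powr \<gamma> * g t) \<le> 11 * (4 * N f) * (real m)\<^sup>2"
      unfolding g_def using m f by (intro dilation_average_error \<gamma> A) auto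
    also have "\<dots> \<le> 11 * (4 * N f) * (real M)\<^sup>2"
      using m f by (intro mult_left_mono power_mono) auto
    also have "\<dots> = 352 * (real M)\<^sup>2 * (N f / 8)" by simp
    also have "\<dots> \<le> (e * real k) * (N f / 8)"
      using k e f by (intro mult_right_mono) (auto simp: field_simps)
    also have "\<dots> = e * (real k / 8 * N f)" by simp
    also have "\<dots> \<le> e * N g" using low e by (intro mult_left_mono) auto
    finally show ?thesis .
  qed
  moreover have "0 < real k / 8 * N f" using k0 f by simp
  then have "0 < N g" using low by linarith
  ultimately show "\<exists>g. g \<in> X \<and> (\<forall>k. 0 \<le> g k) \<and> 0 < N g \<and>
    (\<forall>m\<in>{1..M}. N (\<lambda>k. dil_up m g k - real m powr \<gamma> * g k) \<le> e * N g)"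
    using g decreasing_in decreasing_nonneg by blast
qed

end

section \<open>Symmetric finite representability\<close>

text \<open>Subadditivity of \<open>u powr \<gamma>\<close>: divide by \<open>t\<close> and use
  \<open>u \<le> u powr \<gamma>\<close> on the unit interval.\<close>

lemma powr_diff_le:
  fixes s t :: real
  assumes "0 < \<gamma>" "\<gamma> \<le> 1" "0 \<le> s" "s \<le> t"
  shows "t powr \<gamma> - s powr \<gamma> \<le> (t - s) powr \<gamma>"
proof (cases "t = 0")
  case False
  then have t: "0 < t" using assms by simp
  have le: "u / t \<le> (u / t) powr \<gamma>" if "0 \<le> u" "u \<le> t" for u
    using powr_mono'[of \<gamma> 1 "u / t"] that assms t by simp
  have "1 = s / t + (t - s) / t" using t by (simp add: add_divide_distrib[symmetric])
  also have "\<dots> \<le> (s / t) powr \<gamma> + ((t - s) / t) powr \<gamma>"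
    using le[of s] le[of "t - s"] assms by (intro add_mono) auto
  also have "\<dots> = (s powr \<gamma> + (t - s) powr \<gamma>) / t powr \<gamma>"
    using assms t by (simp add: powr_divide add_divide_distrib)
  finally have "t powr \<gamma> \<le> s powr \<gamma> + (t - s) powr \<gamma>" using t by (simp add: pos_le_divide_eq)
  then show ?thesis by simp
qed (use assms in auto)

text \<open>Exchanging the residue classes \<open>i\<close> and \<open>j\<close> inside every block
  is an involution of all indices, so it is the required permutation.\<close>

lemma same_ordered_distribution_spread:
  assumes "i < n" "j < n"
  shows "same_ordered_distribution (spread n i g) (spread n j g)"
proof -
  define \<pi> where "\<pi> k = (if k mod n = i then k div n * n + j else if k mod n = j then k div n * n + i else k)" for k
  have dm: "\<pi> k div n = k div n" "\<pi> k mod n = (if k mod n = i then j else if k mod n = j then i else k mod n)" for k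
    using assms by (auto simp: \<pi>_def)
  have "\<pi> (\<pi> k) = k" for k
  proof -
    have "\<pi> (\<pi> k) div n = k div n" by (simp add: dm)
    moreover have "\<pi> (\<pi> k) mod n = k mod n" by (simp add: dm)
    ultimately show ?thesis by (metis div_mult_mod_eq)
  qed
  then have "bij \<pi>" by (intro o_bij[of \<pi>]) auto
  moreover have "spread n j g (\<pi> k) = spread n i g k" for k
    by (simp add: spread_def dm)
  ultimately show ?thesis unfolding same_ordered_distribution_def by blast
qed

lemma same_ordered_distribution_eqdist:
  assumes "same_ordered_distribution x y"
  shows "eqdist x y"
proof -
  obtain \<pi> where "bij \<pi>" "\<And>k. y (\<pi> k) = x k"
    using assms by (auto simp: same_ordered_distribution_def)
  then show ?thesis using eqdist_comp_bij[of \<pi> y] by simp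
qed

lemma sum_spread:
  assumes "0 < n"
  shows "(\<Sum>i<n. a i * spread n i g k) = a (k mod n) * g (k div n)"
proof -
  have "(\<Sum>i<n. a i * spread n i g k) = (\<Sum>i<n. if i = k mod n then a (k mod n) * g (k div n) else 0)"
    by (intro sum.cong) (auto simp: spread_def)
  then show ?thesis using assms by simp
qed

lemma lp_norm_const: "0 < n \<Longrightarrow> lp_norm p n (\<lambda>i. 1) = real n powr (if p = \<infinity> then 0 else 1 / real_of_ereal p)"
  by (auto simp: lp_norm_def image_constant_conv lessThan_empty_iff)

lemma lp_norm_unit:
  assumes "0 < n"
  shows "lp_norm p n (\<lambda>i. if i = 0 then 1 else 0) = 1"
proof -
  have "Max ((\<lambda>i. \<bar>if i = 0 then 1 else 0 :: real\<bar>) ` {..<n}) = 1"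
    using assms by (intro Max_eqI) (auto intro!: image_eqI[of _ _ 0])
  moreover have "(\<Sum>i<n. \<bar>if i = 0 then 1 else 0 :: real\<bar> powr q) = (\<Sum>i<n. if i = 0 then 1 else 0)" for q :: real
    by (intro sum.cong) auto
  ultimately show ?thesis using assms by (simp add: lp_norm_def)
qed

context nontrivial_sym_space
begin

lemma N_abs_cong:
  assumes "x \<in> X" "\<And>k. \<bar>y k\<bar> = \<bar>x k\<bar>"
  shows "N y = N x"
  using solid[OF assms(1), of y] solid(2)[of y x] assms(2) by simp

text \<open>The three parts of the error: rounding each coefficient costs
  \<open>K powr (- \<gamma>)\<close>; the eigenvector error occurs once per slot and once for the
  total dilation; and \<open>n / K\<close> accounts for the total multiplicity \<open>W\<close>
  falling short of \<open>K\<close>.\<close>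

lemma combination_norm:
  assumes g: "g \<in> X" "\<And>k. 0 \<le> g k" and n: "0 < n"
    and b0: "\<And>i. i < n \<Longrightarrow> 0 \<le> b i" and \<gamma>: "0 < \<gamma>" "\<gamma> \<le> 1"
    and b: "(\<Sum>i<n. b i powr (1 / \<gamma>)) = 1"
    and K: "n < K" and e: "0 \<le> e"
    and eig: "\<And>m. m \<in> {1..K} \<Longrightarrow> N (\<lambda>k. dil_up m g k - real m powr \<gamma> * g k) \<le> e * N g"
  shows "\<bar>N (interleave n (\<lambda>i k. b i * g k)) - N g\<bar>
    \<le> (real n * real K powr (- \<gamma>) + (real n + 1) * e + real n / real K) * N g"
proof -
  define c where "c = real K powr (- \<gamma>)"
  define t where "t i = b i powr (1 / \<gamma>)" for i
  \<comment> \<open>Rounding down keeps each \<open>w i\<close> and their total \<open>W\<close> at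
    most \<open>K\<close>, where \<open>eig\<close> applies; \<open>n < K\<close> keeps the total
    positive.\<close>
  define w where "w i = nat \<lfloor>real K * t i\<rfloor>" for i
  define W where "W = (\<Sum>i<n. w i)"
  define z where "z i = (if w i = 0 then (\<lambda>_. 0) else dil_up (w i) g)" for i
  have Ng: "0 \<le> N g" using N_nonneg g(1) .
  have K0: "0 < real K" using K by simp
  have c: "0 < c" "c \<le> 1"
    using K powr_mono[of "-\<gamma>" 0 "real K"] \<gamma> by (auto simp: c_def)
  have t0: "0 \<le> t i" for i by (simp add: t_def)
  have tb: "t i powr \<gamma> = b i" if "i < n" for i
    using b0[OF that] \<gamma> by (simp add: t_def powr_powr)
  have w_le: "real (w i) \<le> real K * t i" and w_gt: "real K * t i < real (w i) + 1" for i
    using t0[of i] by (simp_all add: w_def)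
  have "(\<Sum>i<n. real K * t i) = real K"
    using b by (simp add: sum_distrib_left[symmetric] t_def)
  moreover have "(\<Sum>i<n. real (w i)) \<le> (\<Sum>i<n. real K * t i)" by (intro sum_mono w_le)
  moreover have "(\<Sum>i<n. real K * t i) \<le> (\<Sum>i<n. real (w i) + 1)"
    using w_gt by (intro sum_mono less_imp_le)
  ultimately have W: "real W \<le> real K" "real K \<le> real W + real n"
    by (simp_all add: W_def sum.distrib)
  then have W0: "0 < W" using K by linarith
  have wK: "w i \<le> K" if "i < n" for i
  proof -
    have "w i \<le> W" unfolding W_def using that by (intro member_le_sum) auto
    then show ?thesis using W(1) by simp
  qed
  have zX: "z i \<in> X" for i using dil_up_in(1)[OF _ g(1)] zero_in by (simp add: z_def)
  have zi: "N (\<lambda>k. z i k - real (w i) powr \<gamma> * g k) \<le> e * N g" if "i < n" for i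
    using eig[of "w i"] wK[OF that] e Ng N_zero by (cases "w i = 0") (auto simp: z_def)
  \<comment> \<open>\<open>t i\<close> and \<open>w i / K\<close> differ by at most
    \<open>1 / K\<close>, and \<open>powr_diff_le\<close> turns this into
    \<open>K powr (- \<gamma>) = c\<close> after taking powers.\<close>
  have bw: "\<bar>b i - c * real (w i) powr \<gamma>\<bar> \<le> c" if "i < n" for i
  proof -
    have s: "0 \<le> real (w i) / real K" "real (w i) / real K \<le> t i" "t i - real (w i) / real K \<le> 1 / real K"
    proof -
      have "t i \<le> (real (w i) + 1) / real K"
        using w_gt[of i] K0 by (simp add: pos_le_divide_eq mult.commute)
      then show "t i - real (w i) / real K \<le> 1 / real K" by (simp add: add_divide_distrib)
      show "real (w i) / real K \<le> t i" using w_le[of i] K0 by (simp add: pos_divide_le_eq mult.commute)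
    qed simp
    have "c * real (w i) powr \<gamma> = (real (w i) / real K) powr \<gamma>"
      using K0 by (simp add: c_def powr_divide powr_minus field_simps)
    moreover have "(real (w i) / real K) powr \<gamma> \<le> t i powr \<gamma>"
      using s \<gamma> by (intro powr_mono2) auto
    moreover have "t i powr \<gamma> - (real (w i) / real K) powr \<gamma> \<le> (t i - real (w i) / real K) powr \<gamma>"
      using s \<gamma> by (intro powr_diff_le) auto
    moreover have "(t i - real (w i) / real K) powr \<gamma> \<le> (1 / real K) powr \<gamma>"
      using s \<gamma> by (intro powr_mono2) auto
    moreover have "(1 / real K) powr \<gamma> = c"
      using K0 by (simp add: c_def powr_divide powr_minus field_simps)
    ultimately show ?thesis using tb[OF that] by linarith
  qed
  let ?y = "\<lambda>i k. b i * g k"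
  have yX: "?y i \<in> X" for i by (intro scale_in g)
  have diff: "N (\<lambda>k. ?y i k - c * z i k) \<le> (c + e) * N g" if "i < n" for i
  proof -
    have "?y i k - c * z i k = (b i - c * real (w i) powr \<gamma>) * g k - c * (z i k - real (w i) powr \<gamma> * g k)" for k
      by (simp add: algebra_simps)
    then have "N (\<lambda>k. ?y i k - c * z i k)
      = N (\<lambda>k. (b i - c * real (w i) powr \<gamma>) * g k - c * (z i k - real (w i) powr \<gamma> * g k))" by presburger
    also have "\<dots> \<le> N (\<lambda>k. (b i - c * real (w i) powr \<gamma>) * g k) + N (\<lambda>k. c * (z i k - real (w i) powr \<gamma> * g k))"
      by (intro N_diff scale_in diff_in g zX)
    also have "N (\<lambda>k. (b i - c * real (w i) powr \<gamma>) * g k) = \<bar>b i - c * real (w i) powr \<gamma>\<bar> * N g"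
      by (rule N_scale[OF g(1)])
    also have "\<dots> \<le> c * N g" using bw[OF that] Ng by (intro mult_right_mono) auto
    also have "N (\<lambda>k. c * (z i k - real (w i) powr \<gamma> * g k)) = c * N (\<lambda>k. z i k - real (w i) powr \<gamma> * g k)"
      using c N_scale[OF diff_in[OF zX scale_in[OF g(1)]], of c i "real (w i) powr \<gamma>"] by simp
    also have "\<dots> \<le> 1 * (e * N g)"
      using zi[OF that] c e Ng by (intro mult_mono N_nonneg diff_in scale_in g zX) auto
    finally show ?thesis by (simp add: algebra_simps)
  qed
  have yzX: "interleave n ?y \<in> X" "interleave n z \<in> X"
    using interleave_in(1)[OF n] yX zX by auto
  have "(\<lambda>k. interleave n ?y k - c * interleave n z k) = interleave n (\<lambda>i k. ?y i k - c * z i k)"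
    by (simp add: interleave_def)
  then have "N (\<lambda>k. interleave n ?y k - c * interleave n z k) \<le> (\<Sum>i<n. N (\<lambda>k. ?y i k - c * z i k))"
    using interleave_in(2)[OF n, of "\<lambda>i k. ?y i k - c * z i k"] diff_in[OF yX scale_in[OF zX]] by simp
  also have "\<dots> \<le> (\<Sum>i<n. (c + e) * N g)" using diff by (intro sum_mono) auto
  finally have 1: "N (\<lambda>k. interleave n ?y k - c * interleave n z k) \<le> real n * ((c + e) * N g)" by simp
  have 2: "\<bar>N (interleave n ?y) - c * N (interleave n z)\<bar> \<le> real n * ((c + e) * N g)"
    using N_reverse[OF yzX(1) scale_in[OF yzX(2)], of c] N_scale[OF yzX(2), of c] c 1 by simp
  have "eqdist (interleave n z) (dil_up W g)"
    unfolding W_def by (rule eqdist_interleave_dil_up) (use n W0 in \<open>auto simp: z_def W_def\<close>)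
  then have Nz: "N (interleave n z) = N (dil_up W g)"
    using eqdist_in(2)[OF dil_up_in(1)[OF W0 g(1)]] by blast
  have "\<bar>N (dil_up W g) - N (\<lambda>k. real W powr \<gamma> * g k)\<bar> \<le> e * N g"
    using N_reverse[OF dil_up_in(1)[OF W0 g(1)] scale_in[OF g(1)], of "real W powr \<gamma>"] eig[of W] W W0
    by auto
  then have "\<bar>N (dil_up W g) - real W powr \<gamma> * N g\<bar> \<le> e * N g"
    using N_scale[OF g(1), of "real W powr \<gamma>"] by simp
  then have le: "c * \<bar>N (dil_up W g) - real W powr \<gamma> * N g\<bar> \<le> 1 * (e * N g)"
    using c e Ng by (intro mult_mono) auto
  have "c * N (dil_up W g) - c * real W powr \<gamma> * N g = c * (N (dil_up W g) - real W powr \<gamma> * N g)"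
    by (simp add: right_diff_distrib)
  then have 3: "\<bar>c * N (dil_up W g) - c * real W powr \<gamma> * N g\<bar> \<le> e * N g"
    using le c by (simp only: abs_mult abs_of_pos mult_1)
  define r where "r = c * real W powr \<gamma>"
  have r: "r = (real W / real K) powr \<gamma>"
    using K0 by (simp add: r_def c_def powr_divide powr_minus field_simps)
  have "real W / real K \<le> 1" using W K0 by simp
  then have "r \<le> 1" "real W / real K \<le> r"
    using powr_mono'[of \<gamma> 1 "real W / real K"] \<gamma> W0 K0 powr_mono2[of \<gamma> "real W / real K" 1]
    unfolding r by auto
  moreover have "real K / real K \<le> (real W + real n) / real K" using W by (intro divide_right_mono) auto
  then have "1 - real n / real K \<le> real W / real K" using K0 by (simp add: add_divide_distrib)
  ultimately have "\<bar>r - 1\<bar> \<le> real n / real K" by linarith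
  then have le: "\<bar>r - 1\<bar> * N g \<le> real n / real K * N g" using Ng by (intro mult_right_mono) auto
  have "r * N g - N g = (r - 1) * N g" by (simp add: left_diff_distrib)
  then have 4: "\<bar>r * N g - N g\<bar> \<le> real n / real K * N g"
    using le Ng by (simp only: abs_mult abs_of_nonneg)
  have "\<bar>N (interleave n ?y) - N g\<bar> \<le> real n * ((c + e) * N g) + e * N g + real n / real K * N g"
    using 2 3 4 unfolding Nz r_def by linarith
  also have "\<dots> = (real n * c + (real n + 1) * e + real n / real K) * N g"
    by (simp add: algebra_simps)
  finally show ?thesis by (simp only: c_def)
qed

lemma sym_fin_rep_finite:
  assumes J: "joint_eigenvector \<gamma>" and \<gamma>: "0 < \<gamma>" "\<gamma> \<le> 1"
  shows "sym_fin_rep (ereal (1 / \<gamma>)) X N"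
  unfolding sym_fin_rep_def
proof (intro allI impI)
  fix n :: nat and \<epsilon> :: real assume \<epsilon>: "0 < \<epsilon>"
  show "\<exists>x. (\<forall>i<n. x i \<in> X) \<and>
        (\<forall>i<n. \<forall>j<n. i \<noteq> j \<longrightarrow> (\<forall>k. x i k = 0 \<or> x j k = 0)) \<and>
        (\<forall>i<n. \<forall>j<n. same_ordered_distribution (x i) (x j)) \<and>
        (\<forall>a. lp_norm (ereal (1 / \<gamma>)) n a / (1 + \<epsilon>) \<le> N (\<lambda>k. \<Sum>i<n. a i * x i k) \<and>
            N (\<lambda>k. \<Sum>i<n. a i * x i k) \<le> (1 + \<epsilon>) * lp_norm (ereal (1 / \<gamma>)) n a)"
  proof (cases "n = 0")
    case True
    then show ?thesis by (simp add: lp_norm_def N_zero)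
  next
    case False
    then have n: "0 < n" by simp
    \<comment> \<open>Makes the lower constant \<open>1 - \<eta>\<close> exactly
      \<open>1 / (1 + \<epsilon>)\<close>, while \<open>1 + \<eta>\<close> stays within
      \<open>1 + \<epsilon>\<close>.\<close>
    define \<eta> where "\<eta> = \<epsilon> / (1 + \<epsilon>)"
    have \<eta>: "0 < \<eta>" "\<eta> \<le> \<epsilon>" "1 - \<eta> = 1 / (1 + \<epsilon>)"
      using \<epsilon> by (auto simp: \<eta>_def field_simps)
    \<comment> \<open>Half of \<open>\<eta>\<close> is spent on eigenvector errors and a quarter on
      each of the two terms that vanish as \<open>K\<close> grows.\<close>
    define e where "e = \<eta> / 2 / (real n + 1)"
    have e: "0 < e" using \<eta> by (simp add: e_def)
    have lim1: "((\<lambda>K. real n * real K powr (- \<gamma>)) \<longlongrightarrow> 0) sequentially"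
      and lim2: "((\<lambda>K. real n / real K) \<longlongrightarrow> 0) sequentially"
      using \<gamma> by real_asymp+
    have "eventually (\<lambda>K. real n * real K powr (- \<gamma>) < \<eta> / 4) sequentially"
      "eventually (\<lambda>K. real n / real K < \<eta> / 4) sequentially"
      using order_tendstoD(2)[OF lim1, of "\<eta> / 4"] order_tendstoD(2)[OF lim2, of "\<eta> / 4"] \<eta> by simp_all
    then have "eventually (\<lambda>K. real n * real K powr (- \<gamma>) < \<eta> / 4 \<and> real n / real K < \<eta> / 4 \<and> n < K) sequentially"
      using eventually_gt_at_top[of n] by eventually_elim auto
    then obtain K where K: "real n * real K powr (- \<gamma>) < \<eta> / 4" "real n / real K < \<eta> / 4" "n < K"
      using eventually_happens[of _ sequentially] by auto
    obtain g where g: "g \<in> X" "\<And>k. 0 \<le> g k" "0 < N g"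
      and eig: "\<And>m. m \<in> {1..K} \<Longrightarrow> N (\<lambda>k. dil_up m g k - real m powr \<gamma> * g k) \<le> e * N g"
      using J e unfolding joint_eigenvector_def by meson
    define x where "x i = spread n i (\<lambda>k. 1 / N g * g k)" for i
    have xX: "x i \<in> X" if "i < n" for i
      unfolding x_def using spread_in(1)[OF scale_in[OF g(1)] that] .
    have comb: "lp_norm (ereal (1 / \<gamma>)) n a / (1 + \<epsilon>) \<le> N (\<lambda>k. \<Sum>i<n. a i * x i k) \<and>
            N (\<lambda>k. \<Sum>i<n. a i * x i k) \<le> (1 + \<epsilon>) * lp_norm (ereal (1 / \<gamma>)) n a" for a
    proof -
      define q where "q = (\<Sum>i<n. \<bar>a i\<bar> powr (1 / \<gamma>))"
      define s where "s = lp_norm (ereal (1 / \<gamma>)) n a"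
      have s: "s = q powr \<gamma>" by (simp add: s_def q_def lp_norm_def)
      have q0: "0 \<le> q" unfolding q_def by (intro sum_nonneg) auto
      show ?thesis
      proof (cases "q = 0")
        case True
        then have "\<bar>a i\<bar> powr (1 / \<gamma>) = 0" if "i < n" for i
          using that unfolding q_def by (subst (asm) sum_nonneg_eq_0_iff) auto
        then have "(\<lambda>k. \<Sum>i<n. a i * x i k) = (\<lambda>k. 0)" by simp
        then show ?thesis using True s by (simp add: s_def[symmetric] N_zero)
      next
        case False
        then have s0: "0 < s" using q0 by (simp add: s)
        define b where "b i = \<bar>a i\<bar> / s" for i
        have "s powr (1 / \<gamma>) = q" using \<gamma> q0 by (simp add: s powr_powr)
        then have "b i powr (1 / \<gamma>) = \<bar>a i\<bar> powr (1 / \<gamma>) / q" for i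
          using s0 by (simp add: b_def powr_divide)
        then have "(\<Sum>i<n. b i powr (1 / \<gamma>)) = 1"
          using False by (simp add: sum_divide_distrib[symmetric] q_def)
        then have "\<bar>N (interleave n (\<lambda>i k. b i * g k)) - N g\<bar>
          \<le> (real n * real K powr (- \<gamma>) + (real n + 1) * e + real n / real K) * N g"
          using g s0 e by (intro combination_norm n \<gamma> K eig) (auto simp: b_def)
        also have "\<dots> \<le> \<eta> * N g"
        proof (rule mult_right_mono)
          have "real n + 1 \<noteq> 0" by linarith
          then have "(real n + 1) * e = \<eta> / 2" unfolding e_def by (metis mult.commute nonzero_divide_eq_eq)
          then show "real n * real K powr (- \<gamma>) + (real n + 1) * e + real n / real K \<le> \<eta>"
            using K by linarith
        qed (use g in simp)
        finally have near: "\<bar>N (interleave n (\<lambda>i k. b i * g k)) - N g\<bar> \<le> \<eta> * N g" .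
        have iX: "interleave n (\<lambda>i k. b i * g k) \<in> X"
          by (intro interleave_in n scale_in g)
        \<comment> \<open>On disjoint supports the signs of the coefficients do not affect absolute
          values, so the nonnegative \<open>b\<close> may replace \<open>a\<close>.\<close>
        have "N (\<lambda>k. \<Sum>i<n. a i * x i k) = N (\<lambda>k. (s / N g) * interleave n (\<lambda>i k. b i * g k) k)"
        proof (rule N_abs_cong)
          show "(\<lambda>k. (s / N g) * interleave n (\<lambda>i k. b i * g k) k) \<in> X" by (intro scale_in iX)
          show "\<bar>\<Sum>i<n. a i * x i k\<bar> = \<bar>(s / N g) * interleave n (\<lambda>i k. b i * g k) k\<bar>" for k
            unfolding x_def sum_spread[OF n] using s0 g
            by (simp add: interleave_def b_def abs_mult)
        qed
        also have "\<dots> = s / N g * N (interleave n (\<lambda>i k. b i * g k))"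
          using N_scale[OF iX, of "s / N g"] s0 g by simp
        finally have eq: "N (\<lambda>k. \<Sum>i<n. a i * x i k) = s / N g * N (interleave n (\<lambda>i k. b i * g k))" .
        have "s / N g * ((1 - \<eta>) * N g) \<le> N (\<lambda>k. \<Sum>i<n. a i * x i k)"
          unfolding eq using near s0 g by (intro mult_left_mono) (auto simp: abs_le_iff algebra_simps)
        moreover have "N (\<lambda>k. \<Sum>i<n. a i * x i k) \<le> s / N g * ((1 + \<eta>) * N g)"
          unfolding eq using near s0 g by (intro mult_left_mono) (auto simp: abs_le_iff algebra_simps)
        moreover have "s / N g * ((1 - \<eta>) * N g) = s / (1 + \<epsilon>)"
          unfolding \<eta>(3) using g by simp
        moreover have "s / N g * ((1 + \<eta>) * N g) = (1 + \<eta>) * s" using g by simp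
        moreover have "(1 + \<eta>) * s \<le> (1 + \<epsilon>) * s" using \<eta> s0 by (intro mult_right_mono) auto
        ultimately show ?thesis unfolding s_def by linarith
      qed
    qed
    show ?thesis
    proof (intro exI[of _ x] conjI allI impI)
      show "same_ordered_distribution (x i) (x j)" if "i < n" "j < n" for i j
        unfolding x_def using that by (rule same_ordered_distribution_spread)
      show "x i k = 0 \<or> x j k = 0" if "i \<noteq> j" for i j k
        using that by (auto simp: x_def spread_def)
    qed (use xX comb in auto)
  qed
qed

text \<open>Only the dilation by \<open>n\<close> matters. The largest coefficient dominates the
  whole combination by a multiple of \<open>dil_up n g\<close>, whose norm is nearly
  \<open>N g\<close>; the single copy carrying that coefficient gives the lower bound without
  loss.\<close>

lemma sym_fin_rep_infinity:
  assumes J: "joint_eigenvector 0"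
  shows "sym_fin_rep \<infinity> X N"
  unfolding sym_fin_rep_def
proof (intro allI impI)
  fix n :: nat and \<epsilon> :: real assume \<epsilon>: "0 < \<epsilon>"
  show "\<exists>x. (\<forall>i<n. x i \<in> X) \<and>
        (\<forall>i<n. \<forall>j<n. i \<noteq> j \<longrightarrow> (\<forall>k. x i k = 0 \<or> x j k = 0)) \<and>
        (\<forall>i<n. \<forall>j<n. same_ordered_distribution (x i) (x j)) \<and>
        (\<forall>a. lp_norm \<infinity> n a / (1 + \<epsilon>) \<le> N (\<lambda>k. \<Sum>i<n. a i * x i k) \<and>
            N (\<lambda>k. \<Sum>i<n. a i * x i k) \<le> (1 + \<epsilon>) * lp_norm \<infinity> n a)"
  proof (cases "n = 0")
    case True
    then show ?thesis by (simp add: lp_norm_def N_zero)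
  next
    case False
    then have n: "0 < n" by simp
    obtain g where g: "g \<in> X" "\<And>k. 0 \<le> g k" "0 < N g"
      and eig: "\<And>m. m \<in> {1..n} \<Longrightarrow> N (\<lambda>k. dil_up m g k - real m powr 0 * g k) \<le> \<epsilon> * N g"
      using J \<epsilon> unfolding joint_eigenvector_def by meson
    have dX: "dil_up n g \<in> X" by (rule dil_up_in(1)[OF n g(1)])
    have up: "N (dil_up n g) \<le> (1 + \<epsilon>) * N g"
      using eig[of n] n N_reverse[OF dX g(1)] by (simp add: abs_le_iff algebra_simps)
    define x where "x i = spread n i (\<lambda>k. 1 / N g * g k)" for i
    have xX: "x i \<in> X" if "i < n" for i
      unfolding x_def using spread_in(1)[OF scale_in[OF g(1)] that] .
    have comb: "lp_norm \<infinity> n a / (1 + \<epsilon>) \<le> N (\<lambda>k. \<Sum>i<n. a i * x i k) \<and>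
            N (\<lambda>k. \<Sum>i<n. a i * x i k) \<le> (1 + \<epsilon>) * lp_norm \<infinity> n a" for a
    proof -
      define s where "s = Max ((\<lambda>i. \<bar>a i\<bar>) ` {..<n})"
      have s: "lp_norm \<infinity> n a = s" using n by (simp add: lp_norm_def s_def)
      have a_le: "\<bar>a i\<bar> \<le> s" if "i < n" for i unfolding s_def using that by (intro Max_ge) auto
      have "s \<in> (\<lambda>i. \<bar>a i\<bar>) ` {..<n}" unfolding s_def using n by (intro Max_in) auto
      then obtain i where i: "i < n" "s = \<bar>a i\<bar>" by auto
      then have s0: "0 \<le> s" by simp
      have abs: "\<bar>\<Sum>i<n. a i * x i k\<bar> = \<bar>a (k mod n)\<bar> * (g (k div n) / N g)" for k
        unfolding x_def sum_spread[OF n] using g by (simp add: abs_mult)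
      have le: "\<bar>\<Sum>i<n. a i * x i k\<bar> \<le> \<bar>s / N g * dil_up n g k\<bar>" for k
        unfolding abs using a_le[of "k mod n"] n g s0 mult_right_mono[of "\<bar>a (k mod n)\<bar>" s "g (k div n) / N g"]
        by (simp add: dil_up_def abs_mult)
      have sum: "(\<lambda>k. \<Sum>i<n. a i * x i k) \<in> X" "N (\<lambda>k. \<Sum>i<n. a i * x i k) \<le> s / N g * N (dil_up n g)"
        using solid[OF scale_in[OF dX] le] N_scale[OF dX, of "s / N g"] s0 g by auto
      have "s / N g * N (dil_up n g) \<le> s / N g * ((1 + \<epsilon>) * N g)"
        using up s0 g by (intro mult_left_mono) auto
      then have upper: "N (\<lambda>k. \<Sum>i<n. a i * x i k) \<le> (1 + \<epsilon>) * s" using sum g by (simp add: mult.commute)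
      have "\<bar>s / N g * spread n i g k\<bar> \<le> \<bar>\<Sum>i<n. a i * x i k\<bar>" for k
        unfolding abs using g(3) by (cases "k mod n = i") (simp_all add: spread_def abs_mult i g(2))
      then have "N (\<lambda>k. s / N g * spread n i g k) \<le> N (\<lambda>k. \<Sum>i<n. a i * x i k)"
        by (rule solid(2)[OF sum(1)])
      then have lower: "s \<le> N (\<lambda>k. \<Sum>i<n. a i * x i k)"
        using N_scale[OF spread_in(1)[OF g(1) i(1)], of "s / N g"] spread_in(2)[OF g(1) i(1)] s0 g by simp
      moreover have "s / (1 + \<epsilon>) \<le> s" using s0 \<epsilon> by (simp add: divide_le_eq mult_left_le algebra_simps)
      ultimately show ?thesis unfolding s using upper by linarith
    qed
    show ?thesis
    proof (intro exI[of _ x] conjI allI impI)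
      show "same_ordered_distribution (x i) (x j)" if "i < n" "j < n" for i j
        unfolding x_def using that by (rule same_ordered_distribution_spread)
      show "x i k = 0 \<or> x j k = 0" if "i \<noteq> j" for i j k
        using that by (auto simp: x_def spread_def)
    qed (use xX comb in auto)
  qed
qed

section \<open>Representable exponents lie between the two indices\<close>

lemma sym_fin_rep_growth:
  assumes F: "sym_fin_rep p X N" and n: "0 < n"
  defines "r \<equiv> if p = \<infinity> then 0 else 1 / real_of_ereal p"
  shows "lower_growth n \<le> real n powr r" "real n powr r \<le> upper_growth n"
proof -
  have *: "lower_growth n \<le> (1 + \<epsilon>)\<^sup>2 * real n powr r \<and> real n powr r \<le> (1 + \<epsilon>)\<^sup>2 * upper_growth n"
    if \<epsilon>: "0 < \<epsilon>" for \<epsilon>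
  proof -
    obtain x where x: "\<forall>i<n. x i \<in> X" "\<forall>i<n. \<forall>j<n. i \<noteq> j \<longrightarrow> (\<forall>k. x i k = 0 \<or> x j k = 0)"
      "\<forall>i<n. \<forall>j<n. same_ordered_distribution (x i) (x j)"
      "\<forall>a. lp_norm p n a / (1 + \<epsilon>) \<le> N (\<lambda>k. \<Sum>i<n. a i * x i k) \<and>
            N (\<lambda>k. \<Sum>i<n. a i * x i k) \<le> (1 + \<epsilon>) * lp_norm p n a"
      using F[unfolded sym_fin_rep_def, THEN spec, of n, THEN spec, of \<epsilon>, THEN mp, OF \<epsilon>] by (elim exE conjE)
    have xX: "x i \<in> X" if "i < n" for i using x(1) that by blast
    note norm = spec[OF x(4)]
    \<comment> \<open>The coefficients \<open>(1, 0, ..., 0)\<close> normalise one copy.\<close>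
    have "(\<Sum>i<n. (if i = 0 then 1 else 0) * x i k) = x 0 k" for k
      using n by (simp add: if_distrib[where f = "\<lambda>c. c * _"] cong: if_cong)
    then have x0: "1 / (1 + \<epsilon>) \<le> N (x 0)" "N (x 0) \<le> 1 + \<epsilon>"
      using norm[of "\<lambda>i. if i = 0 then 1 else 0"] lp_norm_unit[OF n, of p] by auto
    \<comment> \<open>With all coefficients 1, the sum is distributed like
      \<open>dil_up n (x 0)\<close> and has norm close to \<open>n powr r\<close>.\<close>
    have "eqdist (\<lambda>k. \<Sum>i<n. x i k) (dil_up n (x 0))"
      using x(2,3) n by (intro eqdist_sum_disjoint same_ordered_distribution_eqdist) auto
    then have "N (\<lambda>k. \<Sum>i<n. x i k) = N (dil_up n (x 0))"
      using eqdist_in(2)[OF dil_up_in(1)[OF n xX[OF n]]] by blast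
    then have d: "real n powr r / (1 + \<epsilon>) \<le> N (dil_up n (x 0))" "N (dil_up n (x 0)) \<le> (1 + \<epsilon>) * real n powr r"
      using norm[of "\<lambda>i. 1"] lp_norm_const[OF n, of p] by (auto simp: r_def)
    have "lower_growth n * (1 / (1 + \<epsilon>)) \<le> lower_growth n * N (x 0)"
      using x0 lower_growth_ge_1[OF n] by (intro mult_left_mono) auto
    also have "\<dots> \<le> (1 + \<epsilon>) * real n powr r"
      using lower_growth_bound[OF n xX[OF n]] d by linarith
    finally have 1: "lower_growth n \<le> (1 + \<epsilon>)\<^sup>2 * real n powr r"
      using \<epsilon> by (simp add: divide_le_eq power2_eq_square mult_ac)
    have "real n powr r / (1 + \<epsilon>) \<le> upper_growth n * N (x 0)"
      using upper_growth_bound[OF n xX[OF n]] d by linarith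
    also have "\<dots> \<le> upper_growth n * (1 + \<epsilon>)"
      using x0 upper_growth_ge_1[OF n] by (intro mult_left_mono) auto
    finally have "real n powr r \<le> (1 + \<epsilon>)\<^sup>2 * upper_growth n"
      using \<epsilon> by (simp add: divide_le_eq power2_eq_square mult_ac)
    with 1 show ?thesis by blast
  qed
  \<comment> \<open>The sequences depend on \<open>\<epsilon>\<close>, but both growth factors and
    \<open>r\<close> do not, so the limit can be taken in the inequalities.\<close>
  have lim: "((\<lambda>\<epsilon>. (1 + \<epsilon>)\<^sup>2 * c) \<longlongrightarrow> c) (at_right 0)" for c :: real
  proof -
    have "((\<lambda>\<epsilon>. (1 + \<epsilon>)\<^sup>2 * c) \<longlongrightarrow> (1 + 0)\<^sup>2 * c) (at_right 0)" by (intro tendsto_intros)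
    then show ?thesis by simp
  qed
  have ev: "eventually (\<lambda>\<epsilon>::real. 0 < \<epsilon>) (at_right 0)" by (simp add: eventually_at_right_less)
  show "lower_growth n \<le> real n powr r"
    by (rule tendsto_lowerbound[OF lim]) (use * ev in \<open>auto elim!: eventually_mono\<close>)
  show "real n powr r \<le> upper_growth n"
    by (rule tendsto_lowerbound[OF lim]) (use * ev in \<open>auto elim!: eventually_mono\<close>)
qed

text \<open>For each \<open>b\<close> below the lower index, a single large \<open>n\<close> gives
  \<open>n powr b \<le> lower_growth n \<le> n powr r\<close> and thus \<open>b \<le> r\<close>; the
  upper index is symmetric.\<close>

lemma sym_fin_rep_exponent:
  assumes F: "sym_fin_rep p X N"
  defines "r \<equiv> if p = \<infinity> then 0 else 1 / real_of_ereal p"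
  shows "boyd_alpha X N \<le> r" "r \<le> boyd_beta X N"
proof -
  show "boyd_alpha X N \<le> r"
  proof (rule dense_le)
    fix b assume "b < boyd_alpha X N"
    then have "eventually (\<lambda>n. real n powr b \<le> lower_growth n \<and> 1 < n) sequentially"
      by (intro eventually_conj lower_growth_eventually eventually_gt_at_top)
    then obtain n where n: "real n powr b \<le> lower_growth n" "1 < n"
      using eventually_happens[of _ sequentially] by auto
    then have "real n powr b \<le> real n powr r"
      using sym_fin_rep_growth(1)[OF F, of n] unfolding r_def by linarith
    then show "b \<le> r" using n by (subst (asm) powr_le_cancel_iff) auto
  qed
  show "r \<le> boyd_beta X N"
  proof (rule dense_ge)
    fix b assume "boyd_beta X N < b"
    then have "eventually (\<lambda>n. upper_growth n \<le> real n powr b \<and> 1 < n) sequentially"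
      by (intro eventually_conj upper_growth_eventually eventually_gt_at_top)
    then obtain n where n: "upper_growth n \<le> real n powr b" "1 < n"
      using eventually_happens[of _ sequentially] by auto
    then have "real n powr r \<le> real n powr b"
      using sym_fin_rep_growth(2)[OF F, of n] unfolding r_def by linarith
    then show "r \<le> b" using n by (subst (asm) powr_le_cancel_iff) auto
  qed
qed

lemma recip_in_F_set:
  assumes "approx_eigenvalue (2 powr \<gamma>)" "0 \<le> \<gamma>" "\<gamma> \<le> 1"
  shows "recip \<gamma> \<in> F_set X N"
proof (cases "\<gamma> = 0")
  case True
  then show ?thesis
    using sym_fin_rep_infinity joint_eigenvector_if_approx_eigenvalue[OF assms]
    by (simp add: recip_def F_set_def)
next
  case False
  then show ?thesis
    using sym_fin_rep_finite joint_eigenvector_if_approx_eigenvalue[OF assms] assms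
    by (simp add: recip_def F_set_def one_ereal_def)
qed

text \<open>Reciprocals reverse the order of the exponents. For \<open>q = \<infinity>\<close> the
  exponent is 0, which forces the lower index to be 0 and \<open>recip\<close> of it to be
  \<open>\<infinity>\<close>.\<close>

lemma F_set_bounds:
  assumes "q \<in> F_set X N"
  shows "q \<le> recip (boyd_alpha X N)" "recip (boyd_beta X N) \<le> q"
proof -
  have q: "1 \<le> q" "sym_fin_rep q X N" using assms by (auto simp: F_set_def)
  note r = sym_fin_rep_exponent[OF q(2)]
  show "q \<le> recip (boyd_alpha X N)"
    using r(1) q(1) boyd_bounds(1)
    by (cases q) (auto simp: recip_def one_ereal_def field_simps)
  show "recip (boyd_beta X N) \<le> q"
  proof (cases q)
    case (real t)
    then have t: "1 \<le> t" "1 / t \<le> boyd_beta X N" using r(2) q(1) by (auto simp: one_ereal_def)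
    then have "0 < boyd_beta X N" by (smt (verit) divide_pos_pos)
    then show ?thesis using t real by (simp add: recip_def field_simps)
  qed (use q in auto)
qed

end

theorem theorem3p5:
  fixes X :: "(nat \<Rightarrow> real) set" and N :: "(nat \<Rightarrow> real) \<Rightarrow> real"
  assumes "symmetric_seq_space X N"
    and "separable_space X N \<or> fatou_property X N"
    and "\<exists>x\<in>X. x \<noteq> (\<lambda>k. 0)"
  shows "F_set X N \<noteq> {}
     \<and> recip (boyd_alpha X N) \<in> F_set X N \<and> (\<forall>q\<in>F_set X N. q \<le> recip (boyd_alpha X N))
     \<and> recip (boyd_beta X N) \<in> F_set X N \<and> (\<forall>q\<in>F_set X N. recip (boyd_beta X N) \<le> q)"
proof -
  interpret nontrivial_sym_space X N
    by unfold_locales (use assms in auto)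
  have "recip (boyd_alpha X N) \<in> F_set X N"
    using approx_eigenvalue_alpha boyd_bounds by (intro recip_in_F_set) auto
  moreover have "recip (boyd_beta X N) \<in> F_set X N"
    using approx_eigenvalue_beta boyd_bounds by (intro recip_in_F_set) auto
  ultimately show ?thesis using F_set_bounds by blast
qed

end
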